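(* Let $m\ge 1$ and let $Q=(q_{i,j})$ be an $m\times m$ matrix of complex-valued, $\pi$-periodic, locally square integrable functions. Let $A=\frac1\pi\int_0^\pi Q(x)\,dx$, let $\mu_1,\dots,\mu_p$ be the distinct eigenvalues of $A$, let $r_j$ be the size of the largest Jordan block of $A$ for the eigenvalue $\mu_j$, and put $\mu_{n,j}(t)=(2n+t)^2+\mu_j$ for $n\in\mathbb Z$. Let $c=MB$, with $M$, $B$ as in the context. Then there is a constant $c_6>0$, independent of $k$ and $t$, such that the following holds for all $t\in(-1,1]$ and all $k\in\mathbb Z$ satisfying $|k|>1$ and $\frac43(2|k|-1)>3c$: every eigenvalue of $L_t(Q)$ lying in the disk $D((2k+t)^2,c)$ is contained in the union of the disks $D(\mu_{n,j}(t),\varepsilon_k)$, $j=1,\dots,p$, $n\in A(k,t)$, where the radius $\varepsilon_k$ (which may depend on $j$) satisfies $\varepsilon_k\le c_6\left(\frac1{|k|}+q_k\right)^{1/r_j}$.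
   Context: For $t\in(-1,1]$, $L_t(Q)$ is the operator in $L_2^m[0,\pi]=L_2([0,\pi];\mathbb C^m)$ generated by the differential expression $-y''+Qy$ and the quasiperiodic conditions $y(\pi)=e^{i\pi t}y(0)$, $y'(\pi)=e^{i\pi t}y'(0)$. Its spectrum consists of eigenvalues. $D(a,\rho)=\{\lambda\in\mathbb C:|\lambda-a|<\rho\}$. A normalized Bloch function is an eigenfunction of some $L_t(Q)$, $t\in(-1,1]$, with $L_2^m[0,\pi]$ norm equal to $1$. $M$ is a constant such that $\sup|\Psi(x)|<M$, where the supremum is over all $x\in[0,\pi]$ and all normalized Bloch functions $\Psi$ (for all $t\in(-1,1]$), and $|\cdot|$ is the norm of $\mathbb C^m$; such a constant exists. $B=\left(\int_0^\pi\sum_{i,j=1}^m|q_{i,j}(x)|^2dx\right)^{1/2}$. The set $A(k,t)$ (not to be confused with the matrix $A$) is: $\{k\}$ if $1/3\le|t|\le 2/3$; $\{k,-k\}$ if $|t|<1/3$; $\{k,-k-1\}$ if $2/3<t\le1$; $\{k,-k+1\}$ if $-1<t<-2/3$. $q_k=\max\{|q_{i,j,s}|:\ i,j=1,\dots,m;\ s\in\{\pm2k,\pm(2k+1),\pm(2k-1)\}\}$, where $q_{i,j,s}=\frac1{\sqrt\pi}\int_0^\pi q_{i,j}(x)e^{-2isx}dx$. *)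

theory Defs
  imports "HOL-Analysis.Analysis" "Jordan_Normal_Form.Spectral_Radius"
begin

no_notation Matrix.vec_index (infixl "$" 100)

definition L2_on :: "real set \<Rightarrow> (real \<Rightarrow> 'b::euclidean_space) \<Rightarrow> bool" where
  "L2_on S f \<longleftrightarrow> f \<in> borel_measurable (lebesgue_on S) \<and>
     integrable (lebesgue_on S) (\<lambda>x. (norm (f x))\<^sup>2)"

definition locally_L2 :: "(real \<Rightarrow> 'b::euclidean_space) \<Rightarrow> bool" where
  "locally_L2 f \<longleftrightarrow> (\<forall>a b. L2_on {a..b} f)"

definition L2_norm :: "(real \<Rightarrow> 'b::euclidean_space) \<Rightarrow> real" where
  "L2_norm f = sqrt (LINT x|lebesgue_on {0..pi}. (norm (f x))\<^sup>2)"

text \<open>Absolute continuity on \<open>[0, \<pi>]\<close>, in the form: \<open>f\<close> is an indefinite Lebesgue integral of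
  \<open>g\<close>. The density \<open>g\<close> is then almost everywhere the derivative of \<open>f\<close>.\<close>

definition abs_cont_deriv ::
  "(real \<Rightarrow> 'b::euclidean_space) \<Rightarrow> (real \<Rightarrow> 'b) \<Rightarrow> bool" where
  "abs_cont_deriv f g \<longleftrightarrow> integrable (lebesgue_on {0..pi}) g \<and>
     (\<forall>x\<in>{0..pi}. f x = f 0 + (LINT s|lebesgue_on {0..x}. g s))"

text \<open>The graph of the operator \<open>L\<^sub>t(Q)\<close>, as a relation between functions whose values outside
  \<open>[0, \<pi>]\<close> are irrelevant: \<open>y\<close> lies in the domain (\<open>y\<close> and \<open>y'\<close> are absolutely continuous,
  \<open>-y'' + Qy\<close> is in \<open>L\<^sub>2\<close>, and the quasiperiodic conditions hold), and \<open>z\<close> is a representative of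
  the value \<open>-y'' + Qy\<close>. Here \<open>y1\<close> is \<open>y'\<close> and \<open>y2\<close> is \<open>y''\<close>; as \<open>y1\<close> is continuous, \<open>y\<close> is
  continuously differentiable and its absolute continuity needs no separate clause. An
  eigenfunction has a continuous representative, so it is nonzero in \<open>L\<^sub>2\<close> iff it is nonzero
  at some point.\<close>

definition L_graph ::
  "(real \<Rightarrow> complex^'m^'m) \<Rightarrow> real \<Rightarrow> (real \<Rightarrow> complex^'m) \<Rightarrow> (real \<Rightarrow> complex^'m) \<Rightarrow> bool" where
  "L_graph Q t y z \<longleftrightarrow> (\<exists>y1 y2.
     (\<forall>x\<in>{0..pi}. (y has_vector_derivative y1 x) (at x within {0..pi})) \<and>
     abs_cont_deriv y1 y2 \<and>
     y pi = cis (pi * t) *s y 0 \<and> y1 pi = cis (pi * t) *s y1 0 \<and>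
     L2_on {0..pi} z \<and>
     (AE x in lebesgue_on {0..pi}. z x = - y2 x + Q x *v y x))"

definition eigenfunction ::
  "(real \<Rightarrow> complex^'m^'m) \<Rightarrow> real \<Rightarrow> complex \<Rightarrow> (real \<Rightarrow> complex^'m) \<Rightarrow> bool" where
  "eigenfunction Q t ev y \<longleftrightarrow>
     (\<exists>x\<in>{0..pi}. y x \<noteq> 0) \<and> L_graph Q t y (\<lambda>x. ev *s y x)"

definition L_eigenvalues :: "(real \<Rightarrow> complex^'m^'m) \<Rightarrow> real \<Rightarrow> complex set" where
  "L_eigenvalues Q t = {ev. \<exists>y. eigenfunction Q t ev y}"

definition normalized_Bloch :: "(real \<Rightarrow> complex^'m^'m) \<Rightarrow> (real \<Rightarrow> complex^'m) set" where
  "normalized_Bloch Q =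
     {\<Psi>. (\<exists>t\<in>{-1<..1}. \<exists>ev. eigenfunction Q t ev \<Psi>) \<and> L2_norm \<Psi> = 1}"

text \<open>The extended reals make a finite supremum part of the claim: \<open>M\<close> strictly exceeds it.\<close>

definition Bloch_bound :: "(real \<Rightarrow> complex^'m^'m) \<Rightarrow> real \<Rightarrow> bool" where
  "Bloch_bound Q M \<longleftrightarrow>
     (SUP \<Psi>\<in>normalized_Bloch Q. SUP x\<in>{0..pi}. ereal (norm (\<Psi> x))) < ereal M"

definition B_const :: "(real \<Rightarrow> complex^'m^'m) \<Rightarrow> real" where
  "B_const Q = sqrt (LINT x|lebesgue_on {0..pi}. (\<Sum>i\<in>UNIV. \<Sum>j\<in>UNIV. (cmod (Q x $ i $ j))\<^sup>2))"

definition mean_matrix :: "(real \<Rightarrow> complex^'m^'m) \<Rightarrow> complex^'m^'m" where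
  "mean_matrix Q = (\<chi> i j. of_real (1 / pi) * (LINT x|lebesgue_on {0..pi}. Q x $ i $ j))"

definition fourier_coeff :: "(real \<Rightarrow> complex^'m^'m) \<Rightarrow> 'm \<Rightarrow> 'm \<Rightarrow> int \<Rightarrow> complex" where
  "fourier_coeff Q i j s = of_real (1 / sqrt pi) *
     (LINT x|lebesgue_on {0..pi}. Q x $ i $ j * exp (- 2 * \<i> * of_int s * of_real x))"

definition q_max :: "(real \<Rightarrow> complex^'m^'m) \<Rightarrow> int \<Rightarrow> real" where
  "q_max Q k = Max {cmod (fourier_coeff Q i j s) | i j s.
     s \<in> {2*k, -(2*k), 2*k+1, -(2*k+1), 2*k-1, -(2*k-1)}}"

text \<open>Transfer to the dimension-as-value matrices of \<open>Jordan_Normal_Form\<close>, along some enumeration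
  of the index type. Another enumeration gives a matrix similar by a permutation, so eigenvalues
  and Jordan blocks do not depend on the choice.\<close>

definition index_enum :: "nat \<Rightarrow> 'm::finite" where
  "index_enum = (SOME f. bij_betw f {..<CARD('m)} UNIV)"

definition to_mat :: "complex^'m^'m \<Rightarrow> complex mat" where
  "to_mat A = Matrix.mat CARD('m) CARD('m) (\<lambda>(i, j). A $ index_enum i $ index_enum j)"

definition max_Jordan_block :: "complex^'m^'m \<Rightarrow> complex \<Rightarrow> nat" where
  "max_Jordan_block A \<mu> =
     Max {r. \<exists>n_as. jordan_nf (to_mat A) n_as \<and> (r, \<mu>) \<in> set n_as}"

definition index_set :: "int \<Rightarrow> real \<Rightarrow> int set" where
  "index_set k t =
     (if \<bar>t\<bar> < 1/3 then {k, -k}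
      else if \<bar>t\<bar> \<le> 2/3 then {k}
      else if t > 0 then {k, -k - 1}
      else {k, -k + 1})"

definition mu_shift :: "int \<Rightarrow> real \<Rightarrow> complex \<Rightarrow> complex" where
  "mu_shift n t \<mu> = of_real ((2 * of_int n + t)\<^sup>2) + \<mu>"

end

theory Submission
  imports Defs
begin

text \<open>Let \<open>y\<close> be an eigenfunction with eigenvalue \<open>\<lambda>\<close> in \<open>D((2k + t)\<^sup>2, c)\<close>, and expand it in the waves
\<open>e\<^sub>n(x) = exp(\<i>(2n + t)x)\<close>, which satisfy the quasiperiodic conditions; let \<open>c\<^sub>n\<close> in \<open>\<complex>\<^sup>m\<close> be its
coefficients. Two integrations by parts turn the differential equation into
\<open>(\<lambda> - (2n + t)\<^sup>2) c\<^sub>n = (Qy)\<^sub>n\<close> (\<open>eigenfunction_coeff_eq\<close>), where the right-hand side is bounded by a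
multiple of the norm of \<open>y\<close>.

Call \<open>n\<close> resonant if it lies in \<open>A(k, t)\<close>. For all other \<open>n\<close> the condition on \<open>k\<close> keeps
\<open>(2n + t)\<^sup>2 - (2k + t)\<^sup>2 = 4(n - k)(n + k + t)\<close> so large that \<open>\<lambda>\<close> has distance at least
\<open>|n - k||n + k + t|\<close> from \<open>(2n + t)\<^sup>2\<close> (\<open>nonresonant_gap\<close>). Hence \<open>c\<^sub>n\<close> is at most a constant over this
product, and the squares of these bounds add up to \<open>O(1/k\<^sup>2)\<close>. As the waves are complete
(\<open>sq_integral_le_of_coeffs\<close>), the part \<open>r\<close> of \<open>y\<close> that remains after its resonant waves are removed has
\<open>L\<^sub>2\<close> norm \<open>O(1/|k|)\<close> (\<open>ex_nonresonant_part_bound\<close>). Working with the norm of \<open>r\<close>, and not with a sum of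
absolute values of coefficients, is what avoids a logarithm in the rate.

In the equation of a resonant \<open>n\<close>, the wave \<open>e\<^sub>n\<close> itself contributes \<open>A c\<^sub>n\<close> to \<open>(Qy)\<^sub>n\<close>; the only other
resonant wave, if there is one, contributes Fourier coefficients of \<open>Q\<close> with index \<open>\<plusminus>2k\<close> or \<open>\<plusminus>(2k \<plusminus> 1)\<close>,
which are at most \<open>q\<^sub>k\<close>; and \<open>r\<close> contributes \<open>O(1/|k|)\<close>. For large \<open>|k|\<close> almost all of the norm of \<open>y\<close> is
carried by the at most two resonant coefficients, so one of them, \<open>v = c\<^sub>n\<close>, is comparable to that norm,
and with \<open>z = \<lambda> - (2n + t)\<^sup>2\<close> one gets \<open>|(A - z)v| \<le> \<eta>|v|\<close>, \<open>\<eta> = O(1/|k| + q\<^sub>k)\<close>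
(\<open>ex_quasi_eigenvector\<close>).

The rest is linear algebra (\<open>quasi_eigenvector_near_spectrum\<close>). The polynomial
\<open>p(x) = \<Prod>\<^sub>j (x - \<mu>\<^sub>j)^r\<^sub>j\<close> annihilates \<open>A\<close>, so \<open>p(z)v = (p(z) - p(A))v\<close> is a bounded multiple of
\<open>(A - z)v\<close> and \<open>|p(z)| = O(\<eta>)\<close>. Only the factor of the eigenvalue \<open>\<mu>\<^sub>j\<close> nearest to \<open>z\<close> can be small, so
\<open>|z - \<mu>\<^sub>j|^r\<^sub>j = O(\<eta>)\<close>. For the remaining bounded \<open>|k|\<close> it suffices to choose the constant so large
that the disk around \<open>(2k + t)\<^sup>2 + \<mu>\<^sub>j\<close> contains \<open>D((2k + t)\<^sup>2, c)\<close>.\<close>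

section \<open>The annihilating polynomial of a Jordan form\<close>

text \<open>The value at \<open>A\<close> of the monic polynomial whose roots are listed. Keeping the roots in a list allows
inductions that peel off one linear factor at a time.\<close>
primrec shift_prod :: "complex mat \<Rightarrow> complex list \<Rightarrow> complex mat" where
  "shift_prod A [] = 1\<^sub>m (dim_row A)"
| "shift_prod A (a # as) = char_matrix A a * shift_prod A as"

lemma shift_prod_carrier [simp]:
  "A \<in> carrier_mat n n \<Longrightarrow> shift_prod A as \<in> carrier_mat n n"
  by (induction as) (auto intro!: mult_carrier_mat[of _ n n])

text \<open>The factor \<open>A - b\<close> of a Jordan block is upper bidiagonal, with zero diagonal if \<open>b\<close> is the
eigenvalue. Each occurrence of the eigenvalue in the list therefore moves the lowest nonzero diagonal up
by one, and the other factors keep it in place.\<close>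
lemma shift_prod_jordan_block_entry:
  assumes "i < n" "j < n" "j < i + count_list as a"
  shows "shift_prod (jordan_block n a) as $$ (i, j) = 0"
  using assms
proof (induction as arbitrary: i)
  case Nil
  then show ?case by simp
next
  case (Cons b as)
  let ?M = "shift_prod (jordan_block n a) as"
  have M: "?M \<in> carrier_mat n n" by simp
  have "(jordan_block n (a - b) * ?M) $$ (i, j) =
      (\<Sum>l = 0..<n. jordan_block n (a - b) $$ (i, l) * ?M $$ (l, j))"
    using Cons.prems carrier_matD[OF M] carrier_matD[OF jordan_block_carrier[of n "a - b"]]
    by (simp add: scalar_prod_def del: jordan_block_index)
  also have "\<dots> = 0"
  proof (rule sum.neutral, safe)
    fix l assume l: "l \<in> {0..<n}"
    show "jordan_block n (a - b) $$ (i, l) * ?M $$ (l, j) = 0"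
    proof (cases "l = i")
      case True
      then show ?thesis
        using Cons.IH[of i] Cons.prems by (cases "a = b") auto
    next
      case False
      then show ?thesis
        using Cons.IH[of l] Cons.prems l by (cases "Suc i = l") (auto split: if_splits)
    qed
  qed
  finally show ?case by (simp add: char_matrix_jordan_block)
qed

lemma shift_prod_jordan_block:
  assumes "n \<le> count_list as a"
  shows "shift_prod (jordan_block n a) as = 0\<^sub>m n n"
proof (rule eq_matI)
  have "shift_prod (jordan_block n a) as \<in> carrier_mat n n" by simp
  then show "dim_row (shift_prod (jordan_block n a) as) = dim_row (0\<^sub>m n n :: complex mat)"
    "dim_col (shift_prod (jordan_block n a) as) = dim_col (0\<^sub>m n n :: complex mat)"
    by (auto simp del: shift_prod_carrier)
qed (use assms shift_prod_jordan_block_entry in auto)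

lemma char_matrix_four_block_diag:
  assumes "A \<in> carrier_mat n n" "D \<in> carrier_mat d d"
  shows "char_matrix (four_block_mat A (0\<^sub>m n d) (0\<^sub>m d n) D) a =
    four_block_mat (char_matrix A a) (0\<^sub>m n d) (0\<^sub>m d n) (char_matrix D a)"
  using assms unfolding char_matrix_def by (intro eq_matI) auto

lemma shift_prod_four_block_diag:
  assumes A: "A \<in> carrier_mat n n" and D: "D \<in> carrier_mat d d"
  shows "shift_prod (four_block_mat A (0\<^sub>m n d) (0\<^sub>m d n) D) as =
    four_block_mat (shift_prod A as) (0\<^sub>m n d) (0\<^sub>m d n) (shift_prod D as)"
proof (induction as)
  case Nil
  then show ?case using assms by simp
next
  case (Cons a as)
  have c: "char_matrix A a \<in> carrier_mat n n" "char_matrix D a \<in> carrier_mat d d"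
    "shift_prod A as \<in> carrier_mat n n" "shift_prod D as \<in> carrier_mat d d"
    using assms by auto
  show ?case
    unfolding shift_prod.simps Cons.IH char_matrix_four_block_diag[OF assms]
    by (subst mult_four_block_mat[OF c(1) _ _ c(2) c(3) _ _ c(4)]) (use c in auto)
qed

lemma shift_prod_jordan_matrix:
  assumes "\<And>n a. (n, a) \<in> set n_as \<Longrightarrow> n \<le> count_list as a"
  shows "shift_prod (jordan_matrix n_as) as =
    0\<^sub>m (sum_list (map fst n_as)) (sum_list (map fst n_as))"
  using assms
proof (induction n_as)
  case Nil
  have "shift_prod (jordan_matrix []) as \<in> carrier_mat 0 0"
    using jordan_matrix_carrier[of "[]"] by (intro shift_prod_carrier) simp
  then have "dim_row (shift_prod (jordan_matrix []) as) = 0"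
    "dim_col (shift_prod (jordan_matrix []) as) = 0"
    by (simp_all only: carrier_mat_def mem_Collect_eq)
  then show ?case by (intro eq_matI) simp_all
next
  case (Cons na n_as)
  obtain n a where na: "na = (n, a)" by force
  have "shift_prod (jordan_matrix n_as) as =
    0\<^sub>m (sum_list (map fst n_as)) (sum_list (map fst n_as))"
    by (rule Cons.IH) (use Cons.prems in auto)
  moreover have "shift_prod (jordan_block n a) as = 0\<^sub>m n n"
    by (rule shift_prod_jordan_block) (use Cons.prems na in auto)
  ultimately show ?case
    unfolding na jordan_matrix_Cons
    by (subst shift_prod_four_block_diag[of _ n _ "sum_list (map fst n_as)"]) auto
qed

lemma shift_prod_similar:
  assumes "similar_mat_wit A J P Q"
  shows "shift_prod A as = P * shift_prod J as * Q"
proof -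
  define n where "n = dim_row A"
  have c: "A \<in> carrier_mat n n" "J \<in> carrier_mat n n" "P \<in> carrier_mat n n" "Q \<in> carrier_mat n n"
    and PQ: "P * Q = 1\<^sub>m n" and QP: "Q * P = 1\<^sub>m n" and A: "A = P * J * Q"
    using similar_mat_witD[OF n_def assms] by blast+
  have ch: "char_matrix A a = P * char_matrix J a * Q" for a
  proof -
    have "P * char_matrix J a * Q = (P * J + P * ((- a) \<cdot>\<^sub>m 1\<^sub>m n)) * Q"
      unfolding char_matrix_def using c by (subst mult_add_distrib_mat[of _ n n _ n]) auto
    also have "\<dots> = P * J * Q + P * ((- a) \<cdot>\<^sub>m 1\<^sub>m n) * Q"
      using c by (subst add_mult_distrib_mat[of _ n n _ _ n]) auto
    also have "P * ((- a) \<cdot>\<^sub>m 1\<^sub>m n) * Q = (- a) \<cdot>\<^sub>m 1\<^sub>m n"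
      using c PQ by (simp add: mult_smult_distrib[of _ n n _ n] mult_smult_assoc_mat[of _ n n _ n])
    finally show ?thesis unfolding A[symmetric] using c by (simp add: char_matrix_def)
  qed
  show ?thesis
  proof (induction as)
    case Nil
    then show ?case using c PQ by simp
  next
    case (Cons a as)
    let ?C = "char_matrix J a" and ?S = "shift_prod J as"
    have cc: "?C \<in> carrier_mat n n" "?S \<in> carrier_mat n n" using c by auto
    have "P * ?C * Q * (P * ?S * Q) = P * ?C * ((Q * P) * (?S * Q))"
      using c cc by (simp add: assoc_mult_mat[of _ n n _ n _ n] mult_carrier_mat[of _ n n _ n])
    also have "\<dots> = P * (?C * ?S) * Q"
      unfolding QP using c cc by (simp add: left_mult_one_mat[of _ n n] assoc_mult_mat[of _ n n _ n _ n] mult_carrier_mat[of _ n n _ n])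
    finally show ?case by (simp add: ch Cons.IH)
  qed
qed

text \<open>By similarity it suffices to annihilate the Jordan blocks one at a time, and a block is
annihilated once its eigenvalue is listed as often as its size.\<close>
lemma shift_prod_eq_0:
  assumes A: "A \<in> carrier_mat n n" and jnf: "jordan_nf A n_as"
    and "\<And>r a. (r, a) \<in> set n_as \<Longrightarrow> r \<le> count_list as a"
  shows "shift_prod A as = 0\<^sub>m n n"
proof -
  obtain P Q where w: "similar_mat_wit A (jordan_matrix n_as) P Q"
    using jnf unfolding jordan_nf_def similar_mat_def by blast
  have c: "P \<in> carrier_mat n n" "Q \<in> carrier_mat n n" "jordan_matrix n_as \<in> carrier_mat n n"
    using similar_mat_witD2[OF A w] by blast+
  then have "sum_list (map fst n_as) = n"
    by (metis carrier_matD(1) jordan_matrix_dim(1))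
  then have "shift_prod (jordan_matrix n_as) as = 0\<^sub>m n n"
    using shift_prod_jordan_matrix[of n_as as] assms(3) by simp
  then show ?thesis
    using shift_prod_similar[OF w, of as] c by simp
qed

text \<open>The counterpart of \<open>shift_prod\<close> for matrices indexed by a type, in terms of its action on a vector,
which is the form used by the estimates.\<close>
primrec shift_apply :: "complex^'m^'m \<Rightarrow> complex list \<Rightarrow> complex^'m \<Rightarrow> complex^'m" where
  "shift_apply A [] v = v"
| "shift_apply A (a # as) v = A *v shift_apply A as v - a *s shift_apply A as v"

definition to_vec :: "complex^'m \<Rightarrow> complex Matrix.vec" where
  "to_vec v = Matrix.vec CARD('m) (\<lambda>i. v $ index_enum i)"

lemma index_enum_bij: "bij_betw (index_enum :: nat \<Rightarrow> 'm::finite) {..<CARD('m)} UNIV"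
proof -
  have "\<exists>f :: nat \<Rightarrow> 'm. bij_betw f {..<CARD('m)} UNIV"
    using ex_bij_betw_nat_finite[of "UNIV :: 'm set"] by (auto simp: atLeast0LessThan)
  then show ?thesis unfolding index_enum_def by (rule someI_ex)
qed

lemma to_mat_carrier [simp]: "to_mat (A :: complex^'m^'m) \<in> carrier_mat CARD('m) CARD('m)"
  unfolding to_mat_def by simp

lemma char_matrix_to_mat_mult_vec:
  fixes A :: "complex^'m^'m"
  shows "char_matrix (to_mat A) a *\<^sub>v to_vec v = to_vec (A *v v - a *s v)"
proof (rule eq_vecI)
  fix i assume "i < dim_vec (to_vec (A *v v - a *s v))"
  then have i: "i < CARD('m)" by (simp add: to_vec_def)
  have "vec_index (char_matrix (to_mat A) a *\<^sub>v to_vec v) i =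
      (\<Sum>l = 0..<CARD('m). (A $ index_enum i $ index_enum l - (if l = i then a else 0)) * v $ index_enum l)"
    using i by (auto simp: char_matrix_def to_mat_def to_vec_def scalar_prod_def intro!: sum.cong)
  also have "\<dots> = (\<Sum>l<CARD('m). A $ index_enum i $ index_enum l * v $ index_enum l)
      - (\<Sum>l<CARD('m). if l = i then a * v $ index_enum l else 0)"
    unfolding left_diff_distrib sum_subtractf atLeast0LessThan
    by (intro arg_cong2[where f = "(-)"] refl sum.cong) simp_all
  also have "(\<Sum>l<CARD('m). A $ index_enum i $ index_enum l * v $ index_enum l) =
      (\<Sum>j\<in>UNIV. A $ index_enum i $ j * v $ j)"
    by (rule sum.reindex_bij_betw[OF index_enum_bij])
  finally show "vec_index (char_matrix (to_mat A) a *\<^sub>v to_vec v) i = vec_index (to_vec (A *v v - a *s v)) i"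
    using i by (simp add: to_vec_def matrix_vector_mult_def)
qed (simp add: to_vec_def to_mat_def char_matrix_def)

lemma to_vec_shift_apply:
  fixes A :: "complex^'m^'m"
  shows "to_vec (shift_apply A as v) = shift_prod (to_mat A) as *\<^sub>v to_vec v"
proof (induction as)
  case Nil
  then show ?case by (simp add: to_vec_def to_mat_def)
next
  case (Cons a as)
  have "shift_prod (to_mat A) (a # as) *\<^sub>v to_vec v
    = char_matrix (to_mat A) a *\<^sub>v (shift_prod (to_mat A) as *\<^sub>v to_vec v)"
    unfolding shift_prod.simps
    by (rule assoc_mult_mat_vec[of _ "CARD('m)" "CARD('m)" _ "CARD('m)"]) (auto simp: to_vec_def)
  then show ?case
    by (simp add: Cons.IH[symmetric] char_matrix_to_mat_mult_vec)
qed

lemma to_vec_eq_0_iff: "to_vec (v :: complex^'m) = 0\<^sub>v CARD('m) \<longleftrightarrow> v = 0"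
proof
  assume v: "to_vec v = 0\<^sub>v CARD('m)"
  show "v = 0"
    unfolding Finite_Cartesian_Product.vec_eq_iff
  proof
    fix j :: 'm
    obtain i where i: "i < CARD('m)" "index_enum i = j"
      using index_enum_bij[where 'm='m] unfolding bij_betw_def by (metis UNIV_I imageE lessThan_iff)
    show "v $ j = 0 $ j"
      using arg_cong[OF v, of "\<lambda>w. vec_index w i"] i by (simp add: to_vec_def)
  qed
qed (auto simp: to_vec_def)

lemma shift_apply_eq_0:
  fixes A :: "complex^'m^'m"
  assumes "shift_prod (to_mat A) as = 0\<^sub>m CARD('m) CARD('m)"
  shows "shift_apply A as v = 0"
proof -
  have "to_vec (shift_apply A as v) = 0\<^sub>v CARD('m)"
    unfolding to_vec_shift_apply assms by (auto simp: to_vec_def)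
  then show ?thesis by (simp add: to_vec_eq_0_iff)
qed

lemma jordan_nf_to_mat_exists: "\<exists>n_as. jordan_nf (to_mat (A :: complex^'m^'m)) n_as"
  using char_poly_factorized[OF to_mat_carrier[of A]] jordan_nf_exists[OF to_mat_carrier[of A]]
  by blast

lemma block_size_le_max_Jordan_block:
  fixes A :: "complex^'m^'m"
  assumes "jordan_nf (to_mat A) n_as" "(r, \<mu>) \<in> set n_as"
  shows "r \<le> max_Jordan_block A \<mu>"
proof -
  let ?S = "{r. \<exists>n_as. jordan_nf (to_mat A) n_as \<and> (r, \<mu>) \<in> set n_as}"
  have "?S \<subseteq> {.. order \<mu> (char_poly (to_mat A))}"
    using jordan_nf_block_size_order_bound by blast
  then have "finite ?S" by (rule finite_subset) simp
  then show ?thesis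
    unfolding max_Jordan_block_def using assms by (intro Max_ge) auto
qed

lemma jordan_nf_spectrum:
  assumes A: "A \<in> carrier_mat n n" and jnf: "jordan_nf (A :: complex mat) n_as"
  shows "spectrum A = snd ` set n_as"
proof -
  have nz: "0 \<notin> fst ` set n_as" using jnf by (simp add: jordan_nf_def)
  \<comment> \<open>blocks of size \<open>0\<close> would give factors \<open>1\<close>, so their exclusion matters here\<close>
  have "poly (char_poly A) x = 0 \<longleftrightarrow> x \<in> snd ` set n_as" for x
  proof -
    have "poly (char_poly A) x = 0 \<longleftrightarrow> 0 \<in> (\<lambda>(r, a). (x - a) ^ r) ` set n_as"
      unfolding jordan_nf_char_poly[OF jnf]
      by (simp add: poly_prod_list prod_list_zero_iff o_def split_def image_iff poly_power)
    also have "\<dots> \<longleftrightarrow> x \<in> snd ` set n_as"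
      using nz by (force simp: image_iff split_def)
    finally show ?thesis .
  qed
  then show ?thesis unfolding spectrum_root_char_poly[OF A] by auto
qed

lemma max_Jordan_block_pos:
  fixes A :: "complex^'m^'m"
  assumes "\<mu> \<in> spectrum (to_mat A)"
  shows "max_Jordan_block A \<mu> \<ge> 1"
proof -
  obtain n_as where jnf: "jordan_nf (to_mat A) n_as" using jordan_nf_to_mat_exists by blast
  then obtain r where r: "(r, \<mu>) \<in> set n_as"
    using assms jordan_nf_spectrum[OF to_mat_carrier jnf] by force
  then have "r \<noteq> 0" using jnf by (force simp: jordan_nf_def)
  then show ?thesis using block_size_le_max_Jordan_block[OF jnf r] by simp
qed

lemma finite_spectrum_to_mat: "finite (spectrum (to_mat (A :: complex^'m^'m)))"
  using card_finite_spectrum[OF to_mat_carrier] by blast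

lemma spectrum_to_mat_nonempty: "spectrum (to_mat (A :: complex^'m^'m)) \<noteq> {}"
  by (rule spectrum_non_empty[OF to_mat_carrier]) simp

lemma count_list_replicate: "count_list (replicate n x) y = (if x = y then n else 0)"
  by (induction n) auto

lemma ex_annihilating_shifts:
  fixes A :: "complex^'m^'m"
  obtains as where "\<And>v. shift_apply A as v = 0"
    and "\<And>z. (\<Prod>a\<leftarrow>as. z - a) = (\<Prod>\<mu>\<in>spectrum (to_mat A). (z - \<mu>) ^ max_Jordan_block A \<mu>)"
proof -
  let ?S = "spectrum (to_mat A)" and ?r = "max_Jordan_block A"
  obtain xs where xs: "set xs = ?S" "distinct xs"
    using finite_distinct_list[OF finite_spectrum_to_mat] by blast
  define as where "as = concat (map (\<lambda>\<mu>. replicate (?r \<mu>) \<mu>) xs)"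
  obtain n_as where jnf: "jordan_nf (to_mat A) n_as" using jordan_nf_to_mat_exists by blast
  have count: "r \<le> count_list as \<mu>" if "(r, \<mu>) \<in> set n_as" for r \<mu>
  proof -
    have "\<mu> \<in> set xs"
      using that xs jordan_nf_spectrum[OF to_mat_carrier jnf] by force
    then obtain ys zs where "xs = ys @ \<mu> # zs" by (meson split_list)
    then have "?r \<mu> \<le> count_list as \<mu>"
      unfolding as_def by (simp add: count_list_append count_list_replicate)
    then show ?thesis using block_size_le_max_Jordan_block[OF jnf that] by simp
  qed
  show ?thesis
  proof
    show "shift_apply A as v = 0" for v
      using shift_apply_eq_0[OF shift_prod_eq_0[OF to_mat_carrier jnf count]] by blast
    show "(\<Prod>a\<leftarrow>as. z - a) = (\<Prod>\<mu>\<in>?S. (z - \<mu>) ^ ?r \<mu>)" for z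
    proof -
      have "(\<Prod>a\<leftarrow>as. z - a) = (\<Prod>\<mu>\<leftarrow>xs. (z - \<mu>) ^ ?r \<mu>)"
        unfolding as_def by (induction xs) (auto simp: prod_list_replicate)
      also have "\<dots> = (\<Prod>\<mu>\<in>?S. (z - \<mu>) ^ ?r \<mu>)"
        using xs by (metis prod.distinct_set_conv_list)
      finally show ?thesis .
    qed
  qed
qed

section \<open>Approximate eigenvectors\<close>
lemma norm_matrix_vector_mult_le:
  fixes A :: "complex^'m^'m"
  shows "norm (A *v v) \<le> onorm ((*v) A) * norm v"
  by (rule onorm) (simp add: matrix_vector_mul_bounded_linear)

lemma norm_vector_scalar_mult [simp]: "norm (a *s v) = norm a * norm (v :: complex^'m)"
  by (simp add: norm_vec_def L2_set_def norm_mult power_mult_distrib flip: sum_distrib_left)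
    (simp add: real_sqrt_mult)

text \<open>This is the divisibility of \<open>p(A) - p(z)\<close> by \<open>A - z\<close> in quantitative form: for \<open>z\<close> in a fixed disk
the quotient has bounded coefficients.\<close>
lemma shift_apply_diff_bound:
  fixes A :: "complex^'m^'m"
  shows "\<exists>C. \<forall>z v. norm z \<le> R \<longrightarrow>
    norm (shift_apply A as v - (\<Prod>a\<leftarrow>as. z - a) *s v) \<le> C * norm (A *v v - z *s v)"
proof (induction as)
  case Nil
  show ?case by (intro exI[of _ 0]) simp
next
  case (Cons a as)
  then obtain C where C: "\<And>z v. norm z \<le> R \<Longrightarrow>
    norm (shift_apply A as v - (\<Prod>a\<leftarrow>as. z - a) *s v) \<le> C * norm (A *v v - z *s v)"
    by blast
  let ?K = "onorm ((*v) A) + norm a"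
  define D where "D = (\<Prod>b\<leftarrow>as. R + norm b)"
  have D: "norm (\<Prod>b\<leftarrow>as. z - b) \<le> D" if "norm z \<le> R" for z
    unfolding D_def
  proof (induction as)
    case (Cons b as)
    have "norm (z - b) \<le> R + norm b" using that norm_triangle_ineq4[of z b] by simp
    then show ?case using Cons by (simp add: norm_mult) (intro mult_mono, auto intro: order_trans[OF norm_ge_zero])
  qed simp
  have K: "?K \<ge> 0" by (simp add: onorm_pos_le matrix_vector_mul_bounded_linear)
  have "norm (shift_apply A (a # as) v - (\<Prod>a\<leftarrow>a # as. z - a) *s v)
      \<le> (?K * C + D) * norm (A *v v - z *s v)" if z: "norm z \<le> R" for z v
  proof -
    define w p where "w = shift_apply A as v" and "p = (\<Prod>a\<leftarrow>as. z - a)"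
    define u where "u = w - p *s v"
    have "shift_apply A (a # as) v - (\<Prod>a\<leftarrow>a # as. z - a) *s v
        = (A *v u - a *s u) + p *s (A *v v - z *s v)"
      unfolding u_def by (simp add: w_def[symmetric] p_def[symmetric] matrix_vector_mult_diff_distrib
          vector_scalar_commute vec_eq_iff algebra_simps)
    also have "norm \<dots> \<le> norm (A *v u - a *s u) + norm p * norm (A *v v - z *s v)"
      using norm_triangle_ineq by (metis norm_vector_scalar_mult)
    also have "norm (A *v u - a *s u) \<le> ?K * norm u"
      using norm_triangle_ineq4[of "A *v u" "a *s u"] norm_matrix_vector_mult_le[of A u]
      by (simp add: algebra_simps)
    also have "\<dots> \<le> ?K * (C * norm (A *v v - z *s v))"
      by (intro mult_left_mono K) (use C[OF z, of v] in \<open>simp add: u_def w_def p_def\<close>)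
    also have "norm p * norm (A *v v - z *s v) \<le> D * norm (A *v v - z *s v)"
      unfolding p_def by (intro mult_right_mono D z) simp
    finally show ?thesis by (simp add: algebra_simps)
  qed
  then show ?case by blast
qed

text \<open>With the annihilating polynomial \<open>p\<close>, the previous lemma gives \<open>|p(z)| \<le> C\<eta>\<close>. All eigenvalues except the one
nearest to \<open>z\<close> stay away from \<open>z\<close> by half the minimal distance \<open>d\<close> between eigenvalues, so the whole
smallness of \<open>p(z)\<close> must come from the nearest eigenvalue, to the power of its largest block. The
constant is uniform in \<open>z\<close> because an approximate eigenvalue is at most the norm of \<open>A\<close> plus \<open>\<eta>\<close>.\<close>
lemma quasi_eigenvector_near_spectrum:
  fixes A :: "complex^'m^'m"
  shows "\<exists>C>0. \<forall>z v \<eta>. v \<noteq> 0 \<and> 0 < \<eta> \<and> \<eta> \<le> R \<and> norm (A *v v - z *s v) \<le> \<eta> * norm v \<longrightarrow>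
    (\<exists>\<mu>\<in>spectrum (to_mat A). norm (z - \<mu>) < C * \<eta> powr (1 / real (max_Jordan_block A \<mu>)))"
proof -
  let ?S = "spectrum (to_mat A)" and ?r = "max_Jordan_block A"
  obtain as where ann: "\<And>v. shift_apply A as v = 0"
    and prod: "\<And>z. (\<Prod>a\<leftarrow>as. z - a) = (\<Prod>\<mu>\<in>?S. (z - \<mu>) ^ ?r \<mu>)"
    using ex_annihilating_shifts by blast
  obtain C where C: "\<And>z v. norm z \<le> onorm ((*v) A) + R \<Longrightarrow>
      norm (shift_apply A as v - (\<Prod>a\<leftarrow>as. z - a) *s v) \<le> C * norm (A *v v - z *s v)"
    using shift_apply_diff_bound[of "onorm ((*v) A) + R" A as] by blast
  note fin = finite_spectrum_to_mat[of A]
  have r: "?r \<mu> \<ge> 1" if "\<mu> \<in> ?S" for \<mu> using max_Jordan_block_pos[OF that] .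
  \<comment> \<open>\<open>d \<le> 1\<close> makes \<open>(d/2)^e\<close> decrease in \<open>e\<close>, so that one power \<open>(d/2)^N\<close> serves for all eigenvalues\<close>
  obtain d where d: "0 < d" "d \<le> 1" and sep: "\<And>\<mu> \<nu>. \<mu> \<in> ?S \<Longrightarrow> \<nu> \<in> ?S \<Longrightarrow> \<mu> \<noteq> \<nu> \<Longrightarrow> d \<le> norm (\<mu> - \<nu>)"
  proof
    let ?D = "(\<lambda>(\<mu>, \<nu>). norm (\<mu> - \<nu>)) ` {p \<in> ?S \<times> ?S. fst p \<noteq> snd p}"
    have "finite ?D" using fin by auto
    then show "0 < Min (insert 1 ?D)" "Min (insert 1 ?D) \<le> 1"
      by (auto simp del: Min_insert Min_le_iff intro!: Min_le)
    show "Min (insert 1 ?D) \<le> norm (\<mu> - \<nu>)" if "\<mu> \<in> ?S" "\<nu> \<in> ?S" "\<mu> \<noteq> \<nu>" for \<mu> \<nu>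
      using \<open>finite ?D\<close> that by (intro Min_le) (auto simp: image_iff intro!: bexI[of _ "(\<mu>, \<nu>)"])
  qed
  define N where "N = (\<Sum>\<mu>\<in>?S. ?r \<mu>)"
  define K where "K = 1 + \<bar>C\<bar> / (d / 2) ^ N"
  have "K \<ge> 1" unfolding K_def using d by simp
  show ?thesis
  proof (rule exI[of _ "2 * K"], intro conjI allI impI)
    show "0 < 2 * K" using \<open>K \<ge> 1\<close> by simp
    fix z v \<eta>
    assume *: "v \<noteq> 0 \<and> 0 < \<eta> \<and> \<eta> \<le> R \<and> norm (A *v v - z *s v) \<le> \<eta> * norm v"
    then have v: "norm v > 0" and \<eta>: "0 < \<eta>" "\<eta> \<le> R"
      and res: "norm (A *v v - z *s v) \<le> \<eta> * norm v" by auto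
    have "norm z * norm v \<le> norm (A *v v) + norm (A *v v - z *s v)"
      by (metis norm_vector_scalar_mult norm_triangle_sub norm_minus_commute)
    also have "\<dots> \<le> (onorm ((*v) A) + R) * norm v"
      using norm_matrix_vector_mult_le[of A v] res mult_right_mono[OF \<eta>(2) norm_ge_zero[of v]]
      by (simp add: algebra_simps)
    finally have z: "norm z \<le> onorm ((*v) A) + R" using v by simp
    have "norm (\<Prod>\<mu>\<in>?S. (z - \<mu>) ^ ?r \<mu>) * norm v \<le> C * norm (A *v v - z *s v)"
      using C[OF z, of v] by (simp add: ann prod)
    also have "\<dots> \<le> \<bar>C\<bar> * (\<eta> * norm v)" using res by (intro mult_mono) auto
    finally have P: "norm (\<Prod>\<mu>\<in>?S. (z - \<mu>) ^ ?r \<mu>) \<le> \<bar>C\<bar> * \<eta>" using v by simp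
    obtain \<mu> where \<mu>: "\<mu> \<in> ?S" and near: "\<And>\<nu>. \<nu> \<in> ?S \<Longrightarrow> norm (z - \<mu>) \<le> norm (z - \<nu>)"
      using ex_min_if_finite[of "(\<lambda>\<nu>. norm (z - \<nu>)) ` ?S"] fin spectrum_to_mat_nonempty[of A]
      by (auto simp: not_less)
    have far: "d / 2 \<le> norm (z - \<nu>)" if "\<nu> \<in> ?S" "\<nu> \<noteq> \<mu>" for \<nu>
      using sep[OF that(1) \<mu> that(2)] near[OF that(1)] norm_triangle_ineq4[of "z - \<mu>" "z - \<nu>"]
      by simp
    have "(d / 2) ^ N \<le> (d / 2) ^ (\<Sum>\<nu>\<in>?S - {\<mu>}. ?r \<nu>)"
      unfolding N_def using d fin by (intro power_decreasing sum_mono2) auto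
    also have "\<dots> = (\<Prod>\<nu>\<in>?S - {\<mu>}. (d / 2) ^ ?r \<nu>)" by (simp add: power_sum)
    also have "\<dots> \<le> (\<Prod>\<nu>\<in>?S - {\<mu>}. norm (z - \<nu>) ^ ?r \<nu>)"
      using far d by (intro prod_mono) (auto intro!: power_mono)
    finally have "norm (z - \<mu>) ^ ?r \<mu> * (d / 2) ^ N \<le>
        norm (z - \<mu>) ^ ?r \<mu> * (\<Prod>\<nu>\<in>?S - {\<mu>}. norm (z - \<nu>) ^ ?r \<nu>)"
      by (intro mult_left_mono) auto
    also have "\<dots> = norm (\<Prod>\<mu>\<in>?S. (z - \<mu>) ^ ?r \<mu>)"
      using fin \<mu> by (simp add: prod.remove[of ?S \<mu>] norm_mult prod_norm[symmetric] norm_power)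
    finally have "norm (z - \<mu>) ^ ?r \<mu> \<le> \<bar>C\<bar> / (d / 2) ^ N * \<eta>"
      using order_trans[OF _ P] d by (simp add: pos_le_divide_eq)
    also have "\<dots> \<le> K * \<eta>" unfolding K_def using \<eta> by (simp add: algebra_simps)
    finally have pow: "norm (z - \<mu>) ^ ?r \<mu> \<le> K * \<eta>" .
    have "norm (z - \<mu>) = (norm (z - \<mu>) ^ ?r \<mu>) powr (1 / ?r \<mu>)"
      using r[OF \<mu>] by (cases "z = \<mu>") (auto simp: powr_powr simp flip: powr_realpow)
    also have "\<dots> \<le> (K * \<eta>) powr (1 / ?r \<mu>)" using pow by (intro powr_mono2) auto
    also have "\<dots> = K powr (1 / ?r \<mu>) * \<eta> powr (1 / ?r \<mu>)"
      using \<open>K \<ge> 1\<close> \<eta> by (simp add: powr_mult)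
    also have "\<dots> \<le> K * \<eta> powr (1 / ?r \<mu>)"
      using powr_mono[of "1 / ?r \<mu>" 1 K] r[OF \<mu>] \<open>K \<ge> 1\<close> by (intro mult_right_mono) auto
    also have "\<dots> < 2 * K * \<eta> powr (1 / ?r \<mu>)" using \<open>K \<ge> 1\<close> \<eta> by simp
    finally show "\<exists>\<mu>\<in>?S. norm (z - \<mu>) < 2 * K * \<eta> powr (1 / real (?r \<mu>))" using \<mu> by blast
  qed
qed

section \<open>Quasiperiodic waves and least squares\<close>

lemma integral_FTC_lebesgue_on:
  fixes f :: "real \<Rightarrow> complex"
  assumes "a \<le> b" "continuous_on {a..b} f"
    and "\<And>x. x \<in> {a..b} \<Longrightarrow> (F has_vector_derivative f x) (at x within {a..b})"
  shows "(LINT x|lebesgue_on {a..b}. f x) = F b - F a"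
proof -
  have "(f has_integral (F b - F a)) {a..b}"
    using assms by (intro fundamental_theorem_of_calculus) auto
  then show ?thesis
    using continuous_imp_integrable_real[OF assms(2)]
    by (simp add: lebesgue_integral_eq_integral integral_unique)
qed

definition wave :: "real \<Rightarrow> int \<Rightarrow> real \<Rightarrow> complex" where
  "wave t n x = cis ((2 * of_int n + t) * x)"

text \<open>The factor \<open>1/\<pi>\<close> makes these the coefficients with respect to the waves themselves, which have norm
\<open>sqrt \<pi>\<close>; the diagonal coefficients of \<open>Q\<close> are then exactly the entries of its mean.\<close>
definition wave_coeff :: "real \<Rightarrow> (real \<Rightarrow> complex) \<Rightarrow> int \<Rightarrow> complex" where
  "wave_coeff t f n = (LINT x|lebesgue_on {0..pi}. f x * cnj (wave t n x)) / pi"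

lemma norm_wave [simp]: "cmod (wave t n x) = 1"
  by (simp add: wave_def)

lemma continuous_on_wave [continuous_intros]: "continuous_on S (wave t n)"
  unfolding wave_def by (intro continuous_intros)

lemma cis_2_int_pi: "cis (2 * of_int k * pi) = 1"
  by (metis cis_multiple_2pi Ints_of_int mult.assoc mult.commute)

lemma integral_cis_2_int:
  "(LINT x|lebesgue_on {0..pi}. cis (2 * of_int k * x)) = (if k = 0 then of_real pi else 0)"
proof (cases "k = 0")
  case True
  then show ?thesis by (simp add: scaleR_conv_of_real measure_restrict_space)
next
  case False
  have "(LINT x|lebesgue_on {0..pi}. cis (2 * of_int k * x)) =
      cis (2 * of_int k * pi) / (2 * of_int k * \<i>) - cis (2 * of_int k * 0) / (2 * of_int k * \<i>)"
  proof (rule integral_FTC_lebesgue_on)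
    fix x :: real
    show "((\<lambda>x. cis (2 * of_int k * x) / (2 * of_int k * \<i>)) has_vector_derivative
        cis (2 * of_int k * x)) (at x within {0..pi})"
      unfolding cis_conv_exp using False
      by (auto intro!: derivative_eq_intros has_vector_derivative_real_field simp: o_def)
  qed (auto intro!: continuous_intros)
  then show ?thesis using False by (simp add: cis_2_int_pi)
qed

lemma wave_cnj_wave: "wave t l x * cnj (wave t n x) = cis (2 * of_int (l - n) * x)"
  by (simp add: wave_def cis_cnj cis_mult algebra_simps)

lemma wave_coeff_wave: "wave_coeff t (wave t l) n = (if l = n then 1 else 0)"
  unfolding wave_coeff_def wave_cnj_wave integral_cis_2_int by simp

lemma integrable_on_0_pi:
  fixes f :: "real \<Rightarrow> 'b::euclidean_space"
  shows "continuous_on {0..pi} f \<Longrightarrow> integrable (lebesgue_on {0..pi}) f"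
  by (rule continuous_imp_integrable_real)

lemma wave_coeff_diff:
  assumes "continuous_on {0..pi} f" "continuous_on {0..pi} g"
  shows "wave_coeff t (\<lambda>x. f x - g x) n = wave_coeff t f n - wave_coeff t g n"
  using assms unfolding wave_coeff_def
  by (simp add: left_diff_distrib Bochner_Integration.integral_diff integrable_on_0_pi
      continuous_intros diff_divide_distrib)

lemma wave_coeff_cmult: "wave_coeff t (\<lambda>x. a * f x) n = a * wave_coeff t f n"
  unfolding wave_coeff_def by (simp add: mult.assoc)

text \<open>Completing the square in the coefficient \<open>a\<close>.\<close>
lemma sq_integral_diff_wave:
  assumes f: "continuous_on {0..pi} f"
  shows "(LINT x|lebesgue_on {0..pi}. (cmod (f x - a * wave t n x))\<^sup>2) =
    (LINT x|lebesgue_on {0..pi}. (cmod (f x))\<^sup>2)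
    + pi * ((cmod (a - wave_coeff t f n))\<^sup>2 - (cmod (wave_coeff t f n))\<^sup>2)"
proof -
  have sq: "(cmod (u - v))\<^sup>2 = (cmod u)\<^sup>2 - 2 * Re (u * cnj v) + (cmod v)\<^sup>2" for u v
    unfolding cmod_power2 by (simp add: power2_eq_square algebra_simps)
  have sq': "(cmod (a - w))\<^sup>2 - (cmod w)\<^sup>2 = (cmod a)\<^sup>2 - 2 * Re (cnj a * w)" for w
    unfolding cmod_power2 by (simp add: power2_eq_square algebra_simps)
  have int: "integrable (lebesgue_on {0..pi}) (\<lambda>x. f x * cnj (wave t n x))"
    using f by (intro integrable_on_0_pi continuous_intros)
  have sq_int: "integrable (lebesgue_on {0..pi}) (\<lambda>x. (cmod (f x))\<^sup>2)"
    using f by (intro integrable_on_0_pi continuous_intros)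
  have int': "integrable (lebesgue_on {0..pi}) (\<lambda>x. Re (cnj a * (f x * cnj (wave t n x))))"
    using f by (intro integrable_on_0_pi continuous_intros)
  have "(LINT x|lebesgue_on {0..pi}. (cmod (f x - a * wave t n x))\<^sup>2) =
      (LINT x|lebesgue_on {0..pi}. (cmod (f x))\<^sup>2
        - 2 * Re (cnj a * (f x * cnj (wave t n x))) + (cmod a)\<^sup>2)"
    by (intro Bochner_Integration.integral_cong) (simp_all add: sq norm_mult mult_ac)
  also have "\<dots> = (LINT x|lebesgue_on {0..pi}. (cmod (f x))\<^sup>2)
      - 2 * (LINT x|lebesgue_on {0..pi}. Re (cnj a * (f x * cnj (wave t n x))))
      + (LINT x|lebesgue_on {0..pi}. (cmod a)\<^sup>2)"
  proof -
    have "(LINT x|lebesgue_on {0..pi}. u x - 2 * v x + w x) = (LINT x|lebesgue_on {0..pi}. u x)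
        - 2 * (LINT x|lebesgue_on {0..pi}. v x) + (LINT x|lebesgue_on {0..pi}. w x)"
      if "integrable (lebesgue_on {0..pi}) u" "integrable (lebesgue_on {0..pi}) v"
        "integrable (lebesgue_on {0..pi}) w" for u v w :: "real \<Rightarrow> real"
      using that by simp
    then show ?thesis using sq_int int' by (simp only: integrable_on_0_pi continuous_on_const)
  qed
  also have "(LINT x|lebesgue_on {0..pi}. Re (cnj a * (f x * cnj (wave t n x)))) =
      Re (cnj a * (pi * wave_coeff t f n))"
    using int by (subst integral_Re) (simp_all add: wave_coeff_def)
  also have "(LINT x|lebesgue_on {0..pi}. (cmod a)\<^sup>2) = pi * (cmod a)\<^sup>2"
    by (simp add: measure_restrict_space)
  finally show ?thesis
    unfolding sq' by (simp add: algebra_simps)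
qed

lemma wave_coeff_diff_sum:
  assumes f: "continuous_on {0..pi} f" and F: "finite F"
  shows "wave_coeff t (\<lambda>x. f x - (\<Sum>l\<in>F. a l * wave t l x)) n =
    wave_coeff t f n - (if n \<in> F then a n else 0)"
  using F
proof induction
  case (insert k F)
  have "wave_coeff t (\<lambda>x. f x - (\<Sum>l\<in>insert k F. a l * wave t l x)) n =
      wave_coeff t (\<lambda>x. (f x - (\<Sum>l\<in>F. a l * wave t l x)) - a k * wave t k x) n"
    using insert by (simp add: algebra_simps)
  also have "\<dots> = wave_coeff t (\<lambda>x. f x - (\<Sum>l\<in>F. a l * wave t l x)) n
      - a k * wave_coeff t (wave t k) n"
    using f by (subst wave_coeff_diff) (auto intro!: continuous_intros simp: wave_coeff_cmult)
  finally show ?case using insert by (auto simp: wave_coeff_wave)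
qed simp

text \<open>The distance of \<open>f\<close> to an arbitrary combination of finitely many waves. With \<open>a\<^sub>l\<close> the coefficients of
\<open>f\<close> it is Pythagoras' theorem and yields Bessel's inequality; with other \<open>a\<^sub>l\<close> it says that the coefficients
of \<open>f\<close> are the best choice.\<close>
lemma sq_integral_diff_sum:
  assumes f: "continuous_on {0..pi} f" and F: "finite F"
  shows "(LINT x|lebesgue_on {0..pi}. (cmod (f x - (\<Sum>l\<in>F. a l * wave t l x)))\<^sup>2) =
    (LINT x|lebesgue_on {0..pi}. (cmod (f x))\<^sup>2)
    + pi * (\<Sum>l\<in>F. (cmod (a l - wave_coeff t f l))\<^sup>2 - (cmod (wave_coeff t f l))\<^sup>2)"
  using F
proof induction
  case (insert k F)
  define g where "g = (\<lambda>x. f x - (\<Sum>l\<in>F. a l * wave t l x))"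
  have g: "continuous_on {0..pi} g" unfolding g_def using f by (intro continuous_intros)
  have gk: "wave_coeff t g k = wave_coeff t f k"
    unfolding g_def using wave_coeff_diff_sum[OF f insert(1)] insert by simp
  have e1: "f x - (\<Sum>l\<in>insert k F. a l * wave t l x) = g x - a k * wave t k x" for x
    using insert by (simp add: g_def algebra_simps)
  have e2: "f x - (\<Sum>l\<in>F. a l * wave t l x) = g x" for x
    by (simp add: g_def)
  have "(LINT x|lebesgue_on {0..pi}. (cmod (f x - (\<Sum>l\<in>insert k F. a l * wave t l x)))\<^sup>2) =
      (LINT x|lebesgue_on {0..pi}. (cmod (g x))\<^sup>2)
      + pi * ((cmod (a k - wave_coeff t f k))\<^sup>2 - (cmod (wave_coeff t f k))\<^sup>2)"
    unfolding e1 sq_integral_diff_wave[OF g] gk by (rule refl)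
  then show ?case
    unfolding insert.IH[unfolded e2] by (simp add: insert(1,2) distrib_left)
qed simp

section \<open>Completeness of the waves\<close>

inductive trig_poly :: "(real \<Rightarrow> complex) \<Rightarrow> bool" where
  single: "trig_poly (\<lambda>x. a * cis (2 * of_int n * x))"
| add: "trig_poly f \<Longrightarrow> trig_poly g \<Longrightarrow> trig_poly (\<lambda>x. f x + g x)"

lemma trig_poly_mult:
  assumes "trig_poly f" "trig_poly g"
  shows "trig_poly (\<lambda>x. f x * g x)"
  using assms(1)
proof induction
  case (single a n)
  from assms(2) show ?case
  proof induction
    case (single b k)
    have "(\<lambda>x. (a * cis (2 * of_int n * x)) * (b * cis (2 * of_int k * x))) =
        (\<lambda>x. (a * b) * cis (2 * of_int (n + k) * x))"
      by (simp add: fun_eq_iff algebra_simps flip: cis_mult)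
    then show ?case by (metis trig_poly.single)
  next
    case (add f g)
    then show ?case using trig_poly.add by (simp add: distrib_left)
  qed
next
  case (add f f')
  then show ?case using trig_poly.add by (simp add: distrib_right)
qed

lemma trig_poly_as_finite_sum:
  assumes "trig_poly f"
  obtains F a where "finite F" "\<And>x. f x = (\<Sum>n\<in>F. a n * cis (2 * of_int n * x))"
proof -
  have "\<exists>F a. finite F \<and> (\<forall>n. n \<notin> F \<longrightarrow> a n = 0) \<and>
      f = (\<lambda>x. \<Sum>n\<in>F. a n * cis (2 * of_int n * x))"
    using assms
  proof induction
    case (single a n)
    show ?case by (intro exI[of _ "{n}"] exI[of _ "\<lambda>k. if k = n then a else 0"]) simp
  next
    case (add f g)
    obtain F a where F: "finite F" "\<forall>n. n \<notin> F \<longrightarrow> a n = 0"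
        and f: "f = (\<lambda>x. \<Sum>n\<in>F. a n * cis (2 * of_int n * x))"
      using add.IH(1) by (elim exE conjE) (rule that)
    obtain G b where G: "finite G" "\<forall>n. n \<notin> G \<longrightarrow> b n = 0"
        and g: "g = (\<lambda>x. \<Sum>n\<in>G. b n * cis (2 * of_int n * x))"
      using add.IH(2) by (elim exE conjE) (rule that)
    have "f x + g x = (\<Sum>n\<in>F \<union> G. (a n + b n) * cis (2 * of_int n * x))" for x
    proof -
      have "f x = (\<Sum>n\<in>F \<union> G. a n * cis (2 * of_int n * x))"
        unfolding f using F G by (intro sum.mono_neutral_left) auto
      moreover have "g x = (\<Sum>n\<in>F \<union> G. b n * cis (2 * of_int n * x))"
        unfolding g using F G by (intro sum.mono_neutral_left) auto
      ultimately show ?thesis by (simp only: distrib_right sum.distrib)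
    qed
    then show ?case using F G
      by (intro exI[of _ "F \<union> G"] exI[of _ "\<lambda>n. a n + b n"]) (simp add: fun_eq_iff)
  qed
  then show ?thesis by (elim exE conjE) (rule that, simp_all)
qed

lemma trig_poly_const: "trig_poly (\<lambda>x. c)"
  using trig_poly.single[of c 0] by simp

text \<open>A linear functional of \<open>exp(2\<i>x)\<close> is a combination of \<open>exp(2\<i>x)\<close> and \<open>exp(-2\<i>x)\<close>; sums and products do
the rest.\<close>
lemma trig_poly_real_polynomial:
  assumes "real_polynomial_function (p :: complex \<Rightarrow> real)"
  shows "trig_poly (\<lambda>x. of_real (p (cis (2 * x))))"
  using assms
proof induction
  case (linear f)
  have "of_real (f (cis (2 * x))) = (f 1 - \<i> * f \<i>) / 2 * cis (2 * of_int 1 * x)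
      + (f 1 + \<i> * f \<i>) / 2 * cis (2 * of_int (-1) * x)" for x
  proof -
    have "f (cis (2 * x)) = f (cos (2 * x) *\<^sub>R 1 + sin (2 * x) *\<^sub>R \<i>)"
      by (rule arg_cong[of _ _ f]) (simp add: complex_eq_iff)
    also have "\<dots> = cos (2 * x) * f 1 + sin (2 * x) * f \<i>"
      using linear by (simp add: bounded_linear.linear linear_add linear_scale)
    finally show ?thesis by (simp add: complex_eq_iff field_simps)
  qed
  then show ?case by (simp only: trig_poly.intros)
next
  case (mult f g)
  then show ?case by (simp add: trig_poly_mult)
qed (auto intro: trig_poly_const trig_poly.add)

text \<open>The map \<open>x \<mapsto> exp(2\<i>x)\<close> from the compact interval onto the circle is a quotient map, and it identifies
only the end points.\<close>
lemma continuous_on_circle_of_periodic: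
  fixes h :: "real \<Rightarrow> complex"
  assumes h: "continuous_on {0..pi} h" and per: "h pi = h 0"
  obtains G where "continuous_on (sphere 0 1) G" "\<And>x. x \<in> {0..pi} \<Longrightarrow> G (cis (2 * x)) = h x"
proof
  define G where "G = (\<lambda>z. h (Arg2pi z / 2))"
  have arg: "Arg2pi (cis (2 * x)) = 2 * x" if "0 \<le> x" "x < pi" for x
    using that by (intro Arg2pi_unique[of 1]) (auto simp: cis_conv_exp)
  show G: "G (cis (2 * x)) = h x" if "x \<in> {0..pi}" for x
  proof (cases "x = pi")
    case True
    then have "cis (2 * x) = cis (2 * 0)" by simp
    then show ?thesis using True per arg[of 0] by (simp add: G_def)
  qed (use that arg[of x] in \<open>simp add: G_def\<close>)
  have im: "(\<lambda>x. cis (2 * x)) ` {0..pi} = sphere 0 1"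
  proof (safe)
    fix z :: complex assume "z \<in> sphere 0 1"
    then have "z = cis (2 * (Arg2pi z / 2))"
      using Arg2pi_eq[of z] by (simp add: cis_conv_exp)
    moreover have "Arg2pi z / 2 \<in> {0..pi}" using Arg2pi_ge_0[of z] Arg2pi_lt_2pi[of z] by simp
    ultimately show "z \<in> (\<lambda>x. cis (2 * x)) ` {0..pi}" by blast
  qed simp
  have "quotient_map (top_of_set {0..pi}) (top_of_set (sphere 0 1)) (\<lambda>x. cis (2 * x))"
    by (rule T1_Spaces.continuous_imp_quotient_map)
      (auto simp: im Hausdorff_space_subtopology compact_space_subtopology intro!: continuous_intros)
  moreover have "continuous_map (top_of_set {0..pi}) euclidean (G \<circ> (\<lambda>x. cis (2 * x)))"
    using continuous_on_eq[OF h, of "\<lambda>x. G (cis (2 * x))"] by (simp add: G o_def)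
  ultimately have "continuous_map (top_of_set (sphere 0 1)) euclidean G"
    by (rule continuous_compose_quotient_map)
  then show "continuous_on (sphere 0 1) G" by simp
qed

lemma periodic_uniform_approx:
  fixes h :: "real \<Rightarrow> complex"
  assumes h: "continuous_on {0..pi} h" and per: "h pi = h 0" and e: "e > 0"
  obtains F a where "finite F"
    "\<And>x. x \<in> {0..pi} \<Longrightarrow> cmod (h x - (\<Sum>n\<in>F. a n * cis (2 * of_int n * x))) < e"
proof -
  obtain G where G: "continuous_on (sphere 0 1) G"
    and Gh: "\<And>x. x \<in> {0..pi} \<Longrightarrow> G (cis (2 * x)) = h x"
    using continuous_on_circle_of_periodic[OF h per] by blast
  have "compact (sphere 0 (1::real) :: complex set)" by simp
  note SW = Stone_Weierstrass_real_polynomial_function[OF this]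
  obtain p where p: "real_polynomial_function p"
      "\<And>z. z \<in> sphere 0 1 \<Longrightarrow> \<bar>Re (G z) - p z\<bar> < e / 2"
    using SW[of "\<lambda>z. Re (G z)" "e / 2"] G e by (auto intro: continuous_intros)
  obtain q where q: "real_polynomial_function q"
      "\<And>z. z \<in> sphere 0 1 \<Longrightarrow> \<bar>Im (G z) - q z\<bar> < e / 2"
    using SW[of "\<lambda>z. Im (G z)" "e / 2"] G e by (auto intro: continuous_intros)
  have "trig_poly (\<lambda>x. of_real (p (cis (2 * x))) + \<i> * of_real (q (cis (2 * x))))"
    by (intro trig_poly.add trig_poly_mult trig_poly_const trig_poly_real_polynomial p q)
  then obtain F a where F: "finite F"
    and a: "\<And>x. of_real (p (cis (2 * x))) + \<i> * of_real (q (cis (2 * x))) =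
      (\<Sum>n\<in>F. a n * cis (2 * of_int n * x))"
    by (rule trig_poly_as_finite_sum) (rule that)
  have "cmod (h x - (\<Sum>n\<in>F. a n * cis (2 * of_int n * x))) < e" if x: "x \<in> {0..pi}" for x
  proof -
    let ?z = "cis (2 * x)"
    have "cmod (h x - (\<Sum>n\<in>F. a n * cis (2 * of_int n * x))) \<le>
        \<bar>Re (G ?z) - p ?z\<bar> + \<bar>Im (G ?z) - q ?z\<bar>"
      unfolding a[symmetric] using cmod_le[of "h x - (of_real (p ?z) + \<i> * of_real (q ?z))"] Gh[OF x]
      by simp
    also have "\<dots> < e" using p(2)[of ?z] q(2)[of ?z] by simp
    finally show ?thesis .
  qed
  then show ?thesis using F that by blast
qed

text \<open>The half of Parseval's identity that needs completeness, stated with a bound on the finite sums so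
that no convergence has to be discussed. After removing the factor \<open>exp(\<i>tx)\<close> the function is periodic, hence
uniformly close to some combination of waves by the Stone-Weierstrass theorem; the combination with the
coefficients of \<open>f\<close> is at least as close in the mean.\<close>
lemma sq_integral_le_of_coeffs:
  assumes f: "continuous_on {0..pi} f" and qp: "f pi = cis (pi * t) * f 0"
    and S: "\<And>F. finite F \<Longrightarrow> (\<Sum>n\<in>F. (cmod (wave_coeff t f n))\<^sup>2) \<le> S"
  shows "(LINT x|lebesgue_on {0..pi}. (cmod (f x))\<^sup>2) \<le> pi * S"
proof (rule field_le_epsilon)
  fix d :: real assume d: "d > 0"
  define e where "e = sqrt (d / pi)"
  have e: "e > 0" "pi * e\<^sup>2 = d" unfolding e_def using d by simp_all
  define h where "h x = cis (- t * x) * f x" for x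
  have hc: "continuous_on {0..pi} h" unfolding h_def using f by (intro continuous_intros)
  have hp: "h pi = h 0" unfolding h_def qp by (simp add: mult.assoc[symmetric] cis_mult)
  obtain F a where F: "finite F"
    and a: "\<And>x. x \<in> {0..pi} \<Longrightarrow> cmod (h x - (\<Sum>n\<in>F. a n * cis (2 * of_int n * x))) < e"
    by (rule periodic_uniform_approx[OF hc hp e(1)]) (rule that)
  have a': "cmod (f x - (\<Sum>n\<in>F. a n * wave t n x)) \<le> e" if "x \<in> {0..pi}" for x
  proof -
    have "f x - (\<Sum>n\<in>F. a n * wave t n x) =
        cis (t * x) * (h x - (\<Sum>n\<in>F. a n * cis (2 * of_int n * x)))"
    proof -
      have p1: "cis (t * x) * h x = f x" by (simp add: h_def mult.assoc[symmetric] cis_mult)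
      have p2: "cis (t * x) * (a n * cis (2 * of_int n * x)) = a n * wave t n x" for n
        by (simp add: wave_def distrib_right add.commute flip: cis_mult)
      show ?thesis by (simp only: right_diff_distrib sum_distrib_left p1 p2)
    qed
    then show ?thesis using a[OF that] by (simp add: norm_mult)
  qed
  have "(LINT x|lebesgue_on {0..pi}. (cmod (f x))\<^sup>2) - pi * S
    \<le> (LINT x|lebesgue_on {0..pi}. (cmod (f x))\<^sup>2)
      + pi * (\<Sum>l\<in>F. (cmod (a l - wave_coeff t f l))\<^sup>2 - (cmod (wave_coeff t f l))\<^sup>2)"
  proof -
    have "pi * (\<Sum>l\<in>F. (cmod (wave_coeff t f l))\<^sup>2) \<le> pi * S"
      using S[OF F] by simp
    moreover have "0 \<le> pi * (\<Sum>l\<in>F. (cmod (a l - wave_coeff t f l))\<^sup>2)"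
      by (simp add: sum_nonneg)
    ultimately show ?thesis unfolding sum_subtractf right_diff_distrib by linarith
  qed
  also have "\<dots> = (LINT x|lebesgue_on {0..pi}. (cmod (f x - (\<Sum>l\<in>F. a l * wave t l x)))\<^sup>2)"
    using sq_integral_diff_sum[OF f F] by simp
  also have "\<dots> \<le> (LINT x|lebesgue_on {0..pi}. e\<^sup>2)"
    using f a' by (intro integral_mono integrable_on_0_pi continuous_intros)
      (auto intro!: power_mono)
  also have "\<dots> = d" using e by (simp add: measure_restrict_space mult.commute)
  finally show "(LINT x|lebesgue_on {0..pi}. (cmod (f x))\<^sup>2) \<le> pi * S + d" by simp
qed

lemma bessel_inequality:
  assumes f: "continuous_on {0..pi} f" and F: "finite F"
  shows "pi * (\<Sum>l\<in>F. (cmod (wave_coeff t f l))\<^sup>2) \<le> (LINT x|lebesgue_on {0..pi}. (cmod (f x))\<^sup>2)"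
proof -
  have "0 \<le> (LINT x|lebesgue_on {0..pi}. (cmod (f x - (\<Sum>l\<in>F. wave_coeff t f l * wave t l x)))\<^sup>2)"
    by (rule integral_nonneg_AE) simp
  then show ?thesis unfolding sq_integral_diff_sum[OF f F] by (simp add: sum_negf)
qed

section \<open>Integration by parts for absolutely continuous functions\<close>
lemma borel_measurable_half_line_integral:
  fixes v :: "real \<Rightarrow> complex"
  assumes [measurable]: "v \<in> borel_measurable borel"
  shows "(\<lambda>x. LINT s|lborel. indicator {..x} s *\<^sub>R v s) \<in> borel_measurable borel"
    "(\<lambda>s. LINT x|lborel. indicator {s..} x *\<^sub>R v x) \<in> borel_measurable borel"
proof -
  have [measurable]: "{p :: real \<times> real. snd p \<le> fst p} \<in> sets (borel \<Otimes>\<^sub>M borel)"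
      "{p :: real \<times> real. fst p \<le> snd p} \<in> sets (borel \<Otimes>\<^sub>M borel)"
    unfolding borel_prod by (intro borel_closed closed_Collect_le continuous_intros)+
  have eq: "indicator {p. snd p \<le> fst p} (x, s) = (indicator {..x} s :: real)"
      "indicator {p. fst p \<le> snd p} (x, s) = (indicator {x..} s :: real)" for x s :: real
    by (simp_all add: indicator_def)
  have "(\<lambda>x. LINT s|lborel. indicator {p. snd p \<le> fst p} (x, s) *\<^sub>R v s) \<in> borel_measurable borel"
    by measurable
  then show "(\<lambda>x. LINT s|lborel. indicator {..x} s *\<^sub>R v s) \<in> borel_measurable borel"
    unfolding eq .
  have "(\<lambda>x. LINT s|lborel. indicator {p. fst p \<le> snd p} (x, s) *\<^sub>R v s) \<in> borel_measurable borel"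
    by measurable
  then show "(\<lambda>s. LINT x|lborel. indicator {s..} x *\<^sub>R v x) \<in> borel_measurable borel"
    unfolding eq .
qed

lemma borel_measurable_lebesgue: "f \<in> borel_measurable borel \<Longrightarrow> f \<in> borel_measurable lebesgue"
  by (simp add: measurable_completion)

lemma Fubini_half_lines:
  fixes v w :: "real \<Rightarrow> complex"
  assumes v: "integrable lborel v" and w: "integrable lborel w"
  shows "(LINT x|lborel. (LINT s|lborel. indicator {..x} s *\<^sub>R v s) * w x) =
    (LINT s|lborel. v s * (LINT x|lborel. indicator {s..} x *\<^sub>R w x))"
proof -
  have [measurable]: "v \<in> borel_measurable borel" "w \<in> borel_measurable borel"
    using v w by (auto dest: borel_measurable_integrable)
  have tensor: "integrable (lborel \<Otimes>\<^sub>M lborel) (\<lambda>(x, s). v s * w x)"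
  proof (rule lborel_pair.Fubini_integrable)
    have "integrable lborel (\<lambda>x. (LINT s|lborel. cmod (v s)) * cmod (w x))"
      using w by (intro integrable_mult_right integrable_norm) auto
    then show "integrable lborel (\<lambda>x. LINT s|lborel. norm (case (x, s) of (x, s) \<Rightarrow> v s * w x))"
      by (simp add: norm_mult)
    show "AE x in lborel. integrable lborel (\<lambda>s. case (x, s) of (x, s) \<Rightarrow> v s * w x)"
      using v by simp
  qed measurable
  have "{p :: real \<times> real. snd p \<le> fst p} \<in> sets borel"
    by (intro borel_closed closed_Collect_le continuous_intros)
  then have [measurable]: "Measurable.pred (borel \<Otimes>\<^sub>M borel) (\<lambda>p :: real \<times> real. snd p \<le> fst p)"
    by (simp add: borel_prod pred_def)
  have int: "integrable (lborel \<Otimes>\<^sub>M lborel) (\<lambda>(x, s). (if s \<le> x then v s * w x else 0))"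
    by (rule Bochner_Integration.integrable_bound[OF tensor])
      (auto simp: split_beta' norm_mult)
  have "(LINT x|lborel. (LINT s|lborel. indicator {..x} s *\<^sub>R v s) * w x) =
      (LINT x|lborel. (LINT s|lborel. (if s \<le> x then v s * w x else 0)))"
    by (subst integral_mult_left_zero[symmetric])
      (auto intro!: Bochner_Integration.integral_cong simp: indicator_def)
  also have "\<dots> = (LINT s|lborel. (LINT x|lborel. (if s \<le> x then v s * w x else 0)))"
    by (rule lborel_pair.Fubini_integral[symmetric, OF int])
  also have "\<dots> = (LINT s|lborel. v s * (LINT x|lborel. indicator {s..} x *\<^sub>R w x))"
    by (subst integral_mult_right_zero[symmetric])
      (auto intro!: Bochner_Integration.integral_cong simp: indicator_def)
  finally show ?thesis .
qed

text \<open>The densities are only Lebesgue measurable, while the product measure in Fubini's theorem is formed from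
Borel measures; an almost everywhere equal Borel function bridges the difference.\<close>
lemma lborel_representative:
  fixes f :: "real \<Rightarrow> complex"
  assumes "integrable lebesgue f"
  obtains v where "integrable lborel v" "AE x in lebesgue. f x = v x"
proof -
  have m: "(\<lambda>x. Re (f x)) \<in> borel_measurable lebesgue" "(\<lambda>x. Im (f x)) \<in> borel_measurable lebesgue"
    using assms borel_measurable_integrable by measurable
  obtain p where p: "p \<in> borel_measurable lborel" "AE x in lborel. Re (f x) = p x"
    using completion_ex_borel_measurable_real[OF m(1)] by blast
  obtain q where q: "q \<in> borel_measurable lborel" "AE x in lborel. Im (f x) = q x"
    using completion_ex_borel_measurable_real[OF m(2)] by blast
  define v where "v x = of_real (p x) + \<i> * of_real (q x)" for x
  have v: "v \<in> borel_measurable lborel"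
    unfolding v_def using p(1) q(1) by measurable
  have ae: "AE x in lebesgue. f x = v x"
    using AE_completion[OF p(2)] AE_completion[OF q(2)]
    by eventually_elim (simp add: v_def complex_eq_iff)
  have "integrable lebesgue v"
    using v by (intro integrable_cong_AE_imp[OF assms _ ae])
      (simp add: borel_measurable_lebesgue)
  then have "integrable lborel v" using v by (simp add: integrable_completion)
  then show ?thesis using ae that by blast
qed

lemma lebesgue_on_Icc_conv:
  fixes f :: "real \<Rightarrow> complex"
  shows "integral\<^sup>L (lebesgue_on {a..b}) f = (LINT x|lebesgue. indicator {a..b} x *\<^sub>R f x)"
    "integrable (lebesgue_on {a..b}) f \<longleftrightarrow> integrable lebesgue (\<lambda>x. indicator {a..b} x *\<^sub>R f x)"
  by (simp_all add: integral_restrict_space integrable_restrict_space)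

lemma abs_cont_continuous:
  fixes u :: "real \<Rightarrow> complex"
  assumes "abs_cont_deriv u u'"
  shows "continuous_on {0..pi} u"
proof -
  have u': "integrable (lebesgue_on {0..pi}) u'"
    and u: "\<And>x. x \<in> {0..pi} \<Longrightarrow> u x = u 0 + (LINT s|lebesgue_on {0..x}. u' s)"
    using assms unfolding abs_cont_deriv_def by blast+
  have eq: "(LINT s|lebesgue_on {0..x}. u' s) = integral {0..x} u'" if "x \<in> {0..pi}" for x
    using integrable_subinterval[OF u', of 0 x] that by (intro lebesgue_integral_eq_integral) auto
  have "continuous_on {0..pi} (\<lambda>x. u 0 + integral {0..x} u')"
    using integrable_on_lebesgue_on[OF u'] by (intro continuous_intros indefinite_integral_continuous_1) simp
  then show ?thesis
    by (rule continuous_on_eq) (metis u eq)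
qed

text \<open>As \<open>u\<close> is differentiable only almost everywhere, the product rule does not apply. Instead, write
\<open>u(x) - u(0)\<close> as the integral of \<open>u'(s)\<close> over \<open>s \<le> x\<close> and exchange the order of integration over the triangle
\<open>0 \<le> s \<le> x \<le> \<pi>\<close>; the inner integral of \<open>g'\<close> over \<open>[s, \<pi>]\<close> is then \<open>g(\<pi>) - g(s)\<close>.\<close>
lemma integration_by_parts_abs_cont:
  fixes u u' g g' :: "real \<Rightarrow> complex"
  assumes ac: "abs_cont_deriv u u'"
    and g: "\<And>x. x \<in> {0..pi} \<Longrightarrow> (g has_vector_derivative g' x) (at x within {0..pi})"
    and g': "continuous_on {0..pi} g'"
  shows "(LINT x|lebesgue_on {0..pi}. u' x * g x) =
    u pi * g pi - u 0 * g 0 - (LINT x|lebesgue_on {0..pi}. u x * g' x)"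
proof -
  have u': "integrable (lebesgue_on {0..pi}) u'"
    and u: "\<And>x. x \<in> {0..pi} \<Longrightarrow> u x = u 0 + (LINT s|lebesgue_on {0..x}. u' s)"
    using ac unfolding abs_cont_deriv_def by blast+
  have gc: "continuous_on {0..pi} g"
    using g by (meson continuous_on_eq_continuous_within has_vector_derivative_continuous)
  obtain v where v: "integrable lborel v"
    and ae: "AE x in lebesgue. indicator {0..pi} x *\<^sub>R u' x = v x"
    using lborel_representative u'[unfolded lebesgue_on_Icc_conv] by blast
  have vm [measurable]: "v \<in> borel_measurable borel" using v by (auto dest: borel_measurable_integrable)
  \<comment> \<open>extended by zero, so that all integrals can be taken over the line\<close>
  define G D where "G x = indicator {0..pi} x *\<^sub>R g x" and "D x = indicator {0..pi} x *\<^sub>R g' x" for x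
  have Gm [measurable]: "G \<in> borel_measurable borel" and Dm [measurable]: "D \<in> borel_measurable borel"
    unfolding G_def D_def using gc g' by (auto intro!: borel_measurable_continuous_on_indicator)
  have D: "integrable lborel D"
    using integrable_on_0_pi[OF g'] unfolding lebesgue_on_Icc_conv D_def[symmetric]
    by (simp add: integrable_completion)
  have uv: "(LINT s|lebesgue_on {0..x}. u' s) = (LINT s|lborel. indicator {..x} s *\<^sub>R v s)"
    if "x \<in> {0..pi}" for x
  proof -
    have "(LINT s|lebesgue_on {0..x}. u' s) = (LINT s|lebesgue. indicator {..x} s *\<^sub>R v s)"
      unfolding lebesgue_on_Icc_conv
    proof (rule integral_cong_AE)
      show "AE s in lebesgue. indicator {0..x} s *\<^sub>R u' s = indicator {..x} s *\<^sub>R v s"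
        using ae by eventually_elim (use that in \<open>auto simp: indicator_def split: if_splits\<close>)
      show "(\<lambda>s. indicator {0..x} s *\<^sub>R u' s) \<in> borel_measurable lebesgue"
        using integrable_subinterval[OF u', of 0 x] that
        unfolding lebesgue_on_Icc_conv by (auto dest: borel_measurable_integrable)
      show "(\<lambda>s. indicator {..x} s *\<^sub>R v s) \<in> borel_measurable lebesgue"
        by (intro borel_measurable_lebesgue) measurable
    qed
    also have "\<dots> = (LINT s|lborel. indicator {..x} s *\<^sub>R v s)"
      by (rule integral_completion) measurable
    finally show ?thesis .
  qed
  have ug: "(LINT x|lebesgue_on {0..pi}. u' x * g x) = (LINT s|lborel. v s * G s)"
  proof -
    have "(LINT x|lebesgue_on {0..pi}. u' x * g x) = (LINT s|lebesgue. v s * G s)"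
      unfolding lebesgue_on_Icc_conv
    proof (rule integral_cong_AE)
      show "AE s in lebesgue. indicator {0..pi} s *\<^sub>R (u' s * g s) = v s * G s"
        using ae by eventually_elim (auto simp: indicator_def G_def split: if_splits)
      have "(\<lambda>s. (indicator {0..pi} s *\<^sub>R u' s) * G s) \<in> borel_measurable lebesgue"
        using borel_measurable_integrable[OF u'[unfolded lebesgue_on_Icc_conv]]
        by (rule borel_measurable_times[OF _ borel_measurable_lebesgue[OF Gm]])
      moreover have "(\<lambda>s. (indicator {0..pi} s *\<^sub>R u' s) * G s) = (\<lambda>s. indicator {0..pi} s *\<^sub>R (u' s * g s))"
        by (auto simp: fun_eq_iff G_def indicator_def)
      ultimately show "(\<lambda>s. indicator {0..pi} s *\<^sub>R (u' s * g s)) \<in> borel_measurable lebesgue" by simp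
      show "(\<lambda>s. v s * G s) \<in> borel_measurable lebesgue"
        by (intro borel_measurable_lebesgue) measurable
    qed
    also have "\<dots> = (LINT s|lborel. v s * G s)"
      by (rule integral_completion) measurable
    finally show ?thesis .
  qed
  have gD: "(LINT x|lborel. indicator {s..} x *\<^sub>R D x) = g pi - g s" if s: "s \<in> {0..pi}" for s
  proof -
    have "g pi - g s = (LINT x|lebesgue_on {s..pi}. g' x)"
      using s g' by (intro integral_FTC_lebesgue_on[symmetric])
        (auto intro: continuous_on_subset has_vector_derivative_within_subset[OF g])
    also have "\<dots> = (LINT x|lebesgue. indicator {s..} x *\<^sub>R D x)"
      unfolding lebesgue_on_Icc_conv D_def using s
      by (intro Bochner_Integration.integral_cong) (auto simp: indicator_def)
    also have "\<dots> = (LINT x|lborel. indicator {s..} x *\<^sub>R D x)"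
      by (rule integral_completion) measurable
    finally show ?thesis by simp
  qed
  have aev: "AE s in lborel. s \<notin> {0..pi} \<longrightarrow> v s = 0"
    using ae unfolding AE_completion_iff by eventually_elim auto
  have int_vG: "integrable lborel (\<lambda>s. v s * G s)"
  proof -
    have "compact (g ` {0..pi})" using gc by (intro compact_continuous_image) auto
    then obtain K where K: "\<And>x. x \<in> {0..pi} \<Longrightarrow> cmod (g x) \<le> K"
      using compact_imp_bounded bounded_iff by (metis imageI)
    have "0 \<le> K" by (rule order_trans[OF norm_ge_zero K[of 0]]) simp
    then have "norm (v s * G s) \<le> norm (v s * of_real K)" for s
      using K by (auto simp: norm_mult G_def indicator_def intro!: mult_left_mono)
    then show ?thesis
      by (intro Bochner_Integration.integrable_bound[OF integrable_mult_left[OF v, of "of_real K"]])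
        simp_all
  qed
  have "(LINT x|lebesgue_on {0..pi}. (u x - u 0) * g' x) =
      (LINT x|lborel. (LINT s|lborel. indicator {..x} s *\<^sub>R v s) * D x)"
  proof -
    have ux: "u x - u 0 = (LINT s|lborel. indicator {..x} s *\<^sub>R v s)" if "x \<in> {0..pi}" for x
      using u[OF that] unfolding uv[OF that] by (metis add_diff_cancel_left')
    have "(LINT x|lebesgue_on {0..pi}. (u x - u 0) * g' x) =
        (LINT x|lebesgue. (LINT s|lborel. indicator {..x} s *\<^sub>R v s) * D x)"
      unfolding lebesgue_on_Icc_conv
    proof (intro Bochner_Integration.integral_cong refl)
      show "indicator {0..pi} x *\<^sub>R ((u x - u 0) * g' x) =
          (LINT s|lborel. indicator {..x} s *\<^sub>R v s) * D x" for x
        by (cases "x \<in> {0..pi}") (simp_all add: ux D_def)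
    qed
    also have "\<dots> = (LINT x|lborel. (LINT s|lborel. indicator {..x} s *\<^sub>R v s) * D x)"
    proof (rule integral_completion)
      note [measurable] = borel_measurable_half_line_integral(1)[OF vm]
      show "(\<lambda>x. (LINT s|lborel. indicator {..x} s *\<^sub>R v s) * D x) \<in> borel_measurable lborel"
        by measurable
    qed
    finally show ?thesis .
  qed
  also have "\<dots> = (LINT s|lborel. v s * (LINT x|lborel. indicator {s..} x *\<^sub>R D x))"
    by (rule Fubini_half_lines[OF v D])
  also have "\<dots> = (LINT s|lborel. v s * g pi - v s * G s)"
  proof (rule integral_cong_AE)
    show eq: "AE s in lborel. v s * (LINT x|lborel. indicator {s..} x *\<^sub>R D x) = v s * g pi - v s * G s"
      using aev
    proof eventually_elim
      case (elim s)
      then show ?case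
        by (cases "s \<in> {0..pi}") (auto simp: gD G_def right_diff_distrib)
    qed
    note [measurable] = borel_measurable_half_line_integral(2)[OF Dm]
    show "(\<lambda>s. v s * (LINT x|lborel. indicator {s..} x *\<^sub>R D x)) \<in> borel_measurable lborel"
      by measurable
  qed measurable
  also have "\<dots> = (LINT s|lborel. v s) * g pi - (LINT s|lborel. v s * G s)"
    using v int_vG by simp
  also have "(LINT s|lborel. v s) = u pi - u 0"
  proof -
    have "(LINT s|lborel. indicator {..pi} s *\<^sub>R v s) = (LINT s|lborel. v s)"
      using aev by (intro integral_cong_AE) (auto simp: indicator_def elim!: eventually_mono)
    then show ?thesis using u[of pi] uv[of pi] by simp
  qed
  finally have main: "(LINT x|lebesgue_on {0..pi}. (u x - u 0) * g' x) =
      (u pi - u 0) * g pi - (LINT x|lebesgue_on {0..pi}. u' x * g x)"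
    by (simp add: ug)
  note uc = abs_cont_continuous[OF ac]
  have "(LINT x|lebesgue_on {0..pi}. (u x - u 0) * g' x) =
      (LINT x|lebesgue_on {0..pi}. u x * g' x) - u 0 * (LINT x|lebesgue_on {0..pi}. g' x)"
    using uc g' by (simp add: left_diff_distrib integrable_on_0_pi continuous_intros)
  also have "(LINT x|lebesgue_on {0..pi}. g' x) = g pi - g 0"
    by (rule integral_FTC_lebesgue_on) (use g g' in auto)
  finally show ?thesis unfolding main by (simp add: algebra_simps)
qed

section \<open>The coefficients of an eigenfunction\<close>

lemma abs_cont_deriv_of_vector_derivative:
  fixes u :: "real \<Rightarrow> complex"
  assumes "\<And>x. x \<in> {0..pi} \<Longrightarrow> (u has_vector_derivative u' x) (at x within {0..pi})"
    and "continuous_on {0..pi} u'"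
  shows "abs_cont_deriv u u'"
  unfolding abs_cont_deriv_def
proof (intro conjI ballI integrable_on_0_pi assms)
  fix x :: real assume x: "x \<in> {0..pi}"
  have "(LINT s|lebesgue_on {0..x}. u' s) = u x - u 0"
    using x assms(2) by (intro integral_FTC_lebesgue_on)
      (auto intro: continuous_on_subset has_vector_derivative_within_subset[OF assms(1)])
  then show "u x = u 0 + (LINT s|lebesgue_on {0..x}. u' s)" by simp
qed

text \<open>The boundary terms cancel because the function and the waves pick up the same factor over the
interval.\<close>
lemma wave_coeff_derivative:
  assumes ac: "abs_cont_deriv u u'" and qp: "u pi = cis (pi * t) * u 0"
  shows "wave_coeff t u' n = \<i> * (2 * of_int n + t) * wave_coeff t u n"
proof -
  let ?w = "2 * of_int n + t :: real"
  have cw: "cnj (wave t n x) = cis (- ?w * x)" for x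
    unfolding wave_def cis_cnj by (rule arg_cong[of _ _ cis]) (simp add: algebra_simps)
  have der: "((\<lambda>x. cnj (wave t n x)) has_vector_derivative - \<i> * ?w * cnj (wave t n x)) (at x within {0..pi})" for x
    unfolding cw cis_conv_exp
    by (auto intro!: derivative_eq_intros has_vector_derivative_real_field simp: o_def algebra_simps)
  have "cis (pi * t) * cnj (wave t n pi) = cis (2 * of_int (- n) * pi)"
    unfolding cw cis_mult by (simp add: algebra_simps)
  also have "\<dots> = 1" by (rule cis_2_int_pi)
  finally have bd: "u pi * cnj (wave t n pi) = u 0 * cnj (wave t n 0)"
    unfolding qp by (simp add: wave_def mult.commute mult.left_commute)
  have "(LINT x|lebesgue_on {0..pi}. u' x * cnj (wave t n x)) =
      - (LINT x|lebesgue_on {0..pi}. u x * (- \<i> * ?w * cnj (wave t n x)))"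
    using integration_by_parts_abs_cont[OF ac der] bd by (simp add: continuous_intros)
  also have "(\<lambda>x. u x * (- \<i> * ?w * cnj (wave t n x))) = (\<lambda>x. (- \<i> * ?w) * (u x * cnj (wave t n x)))"
    by (simp add: fun_eq_iff mult_ac)
  finally show ?thesis unfolding wave_coeff_def by simp
qed

text \<open>A form of the Cauchy-Schwarz inequality that follows pointwise from
\<open>2|q||g| \<le> D|q|\<^sup>2 + |g|\<^sup>2/D\<close>; the parameter \<open>D\<close> will be a bound for the norm of \<open>g\<close>.\<close>
lemma L2_product:
  fixes q g :: "real \<Rightarrow> complex"
  assumes q: "L2_on {0..pi} q" and g: "continuous_on {0..pi} g"
  shows "integrable (lebesgue_on {0..pi}) (\<lambda>x. q x * g x)"
    and "D > 0 \<Longrightarrow> (LINT x|lebesgue_on {0..pi}. cmod (q x * g x)) \<le>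
      (D * (LINT x|lebesgue_on {0..pi}. (cmod (q x))\<^sup>2)
        + (LINT x|lebesgue_on {0..pi}. (cmod (g x))\<^sup>2) / D) / 2"
proof -
  have q2: "integrable (lebesgue_on {0..pi}) (\<lambda>x. (cmod (q x))\<^sup>2)"
    and qm: "q \<in> borel_measurable (lebesgue_on {0..pi})"
    using q by (auto simp: L2_on_def)
  have g2: "integrable (lebesgue_on {0..pi}) (\<lambda>x. (cmod (g x))\<^sup>2)"
    using g by (intro integrable_on_0_pi continuous_intros)
  have gm: "g \<in> borel_measurable (lebesgue_on {0..pi})"
    using borel_measurable_integrable[OF integrable_on_0_pi[OF g]] .
  have amgm: "cmod (q x * g x) \<le> (D * (cmod (q x))\<^sup>2 + (cmod (g x))\<^sup>2 / D) / 2" if "D > 0" for D x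
  proof -
    have "0 \<le> (D * cmod (q x) - cmod (g x))\<^sup>2" by simp
    then show ?thesis using that by (simp add: norm_mult power2_diff field_simps power2_eq_square)
  qed
  have bint: "integrable (lebesgue_on {0..pi}) (\<lambda>x. (D * (cmod (q x))\<^sup>2 + (cmod (g x))\<^sup>2 / D) / 2)" for D
    using q2 g2 by simp
  show int: "integrable (lebesgue_on {0..pi}) (\<lambda>x. q x * g x)"
  proof (rule Bochner_Integration.integrable_bound[OF bint[of 1]])
    show "(\<lambda>x. q x * g x) \<in> borel_measurable (lebesgue_on {0..pi})" using qm gm by measurable
    show "AE x in lebesgue_on {0..pi}. norm (q x * g x)
        \<le> norm ((1 * (cmod (q x))\<^sup>2 + (cmod (g x))\<^sup>2 / 1) / 2)"
      using amgm[of 1] by (intro AE_I2) simp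
  qed
  show "(LINT x|lebesgue_on {0..pi}. cmod (q x * g x)) \<le>
      (D * (LINT x|lebesgue_on {0..pi}. (cmod (q x))\<^sup>2)
        + (LINT x|lebesgue_on {0..pi}. (cmod (g x))\<^sup>2) / D) / 2" if D: "D > 0"
  proof -
    have "(LINT x|lebesgue_on {0..pi}. cmod (q x * g x)) \<le>
        (LINT x|lebesgue_on {0..pi}. (D * (cmod (q x))\<^sup>2 + (cmod (g x))\<^sup>2 / D) / 2)"
      using int by (intro integral_mono bint amgm D) auto
    also have "\<dots> = (D * (LINT x|lebesgue_on {0..pi}. (cmod (q x))\<^sup>2)
        + (LINT x|lebesgue_on {0..pi}. (cmod (g x))\<^sup>2) / D) / 2"
      using q2 g2 by simp
    finally show ?thesis .
  qed
qed

lemma norm_wave_coeff_le: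
  "cmod (wave_coeff t f n) \<le> (LINT x|lebesgue_on {0..pi}. cmod (f x)) / pi"
proof -
  have "cmod (LINT x|lebesgue_on {0..pi}. f x * cnj (wave t n x)) \<le>
      (LINT x|lebesgue_on {0..pi}. cmod (f x * cnj (wave t n x)))"
    by (rule integral_norm_bound)
  also have "\<dots> = (LINT x|lebesgue_on {0..pi}. cmod (f x))" by (simp add: norm_mult)
  finally show ?thesis unfolding wave_coeff_def by (simp add: norm_divide divide_right_mono)
qed

text \<open>Linearity in the bound \<open>D\<close> for the norm of \<open>g\<close> is the point: it passes the smallness of the
nonresonant part of an eigenfunction on to its contribution to the equation of a resonant index.\<close>
lemma norm_wave_coeff_L2_product_le:
  fixes q g :: "real \<Rightarrow> complex"
  assumes q: "L2_on {0..pi} q" and g: "continuous_on {0..pi} g" and D: "0 \<le> D"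
    and "(LINT x|lebesgue_on {0..pi}. (cmod (g x))\<^sup>2) \<le> D\<^sup>2"
  shows "cmod (wave_coeff t (\<lambda>x. q x * g x) n) \<le>
    D * ((LINT x|lebesgue_on {0..pi}. (cmod (q x))\<^sup>2) + 1) / (2 * pi)"
proof (rule field_le_epsilon)
  fix e :: real assume "e > 0"
  define K where "K = (LINT x|lebesgue_on {0..pi}. (cmod (q x))\<^sup>2) + 1"
  have K: "K > 0" unfolding K_def by (intro add_nonneg_pos integral_nonneg_AE) auto
  \<comment> \<open>the parameter of the inequality must be positive, but \<open>D\<close> may be \<open>0\<close>: use \<open>D + d\<close> with a small \<open>d\<close>\<close>
  define d where "d = e * (2 * pi) / K"
  have d: "d > 0" unfolding d_def using \<open>e > 0\<close> K by simp
  have "(LINT x|lebesgue_on {0..pi}. (cmod (g x))\<^sup>2) \<le> (D + d)\<^sup>2"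
    using assms(4) D d power_mono[of D "D + d" 2] by linarith
  then have "(LINT x|lebesgue_on {0..pi}. (cmod (g x))\<^sup>2) / (D + d) \<le> D + d"
    using D d by (simp add: divide_le_eq power2_eq_square)
  then have "(LINT x|lebesgue_on {0..pi}. cmod (q x * g x)) \<le> (D + d) * K / 2"
    using L2_product(2)[OF q g, of "D + d"] D d by (simp add: K_def distrib_left)
  then have "cmod (wave_coeff t (\<lambda>x. q x * g x) n) \<le> (D + d) * K / 2 / pi"
    by (intro order_trans[OF norm_wave_coeff_le] divide_right_mono) auto
  also have "\<dots> = D * K / (2 * pi) + e" unfolding d_def using K by (simp add: field_simps)
  finally show "cmod (wave_coeff t (\<lambda>x. q x * g x) n) \<le>
      D * ((LINT x|lebesgue_on {0..pi}. (cmod (q x))\<^sup>2) + 1) / (2 * pi) + e"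
    by (simp add: K_def)
qed

lemma eigenfunction_components:
  assumes "eigenfunction Q t ev y"
  shows "continuous_on {0..pi} (\<lambda>x. y x $ i)" "y pi $ i = cis (pi * t) * y 0 $ i"
proof -
  obtain y1 y2 where y: "\<forall>x\<in>{0..pi}. (y has_vector_derivative y1 x) (at x within {0..pi})"
    and qp: "y pi = cis (pi * t) *s y 0"
    using assms unfolding eigenfunction_def L_graph_def by blast
  have "continuous_on {0..pi} y"
    using y by (meson continuous_on_eq_continuous_within has_vector_derivative_continuous)
  then show "continuous_on {0..pi} (\<lambda>x. y x $ i)" by (intro continuous_intros)
  show "y pi $ i = cis (pi * t) * y 0 $ i" using qp by simp
qed

text \<open>Differentiating twice multiplies a coefficient by \<open>-(2n + t)\<^sup>2\<close>, so the differential equation becomes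
algebraic in its left-hand side.\<close>
lemma eigenfunction_coeff_eq:
  fixes Q :: "real \<Rightarrow> complex^'m^'m"
  assumes ef: "eigenfunction Q t ev y" and Q: "\<And>i j. L2_on {0..pi} (\<lambda>x. Q x $ i $ j)"
  shows "(ev - of_real ((2 * of_int n + t)\<^sup>2)) * wave_coeff t (\<lambda>x. y x $ i) n =
    (\<Sum>j\<in>UNIV. wave_coeff t (\<lambda>x. Q x $ i $ j * y x $ j) n)"
proof -
  obtain y1 y2 where y: "\<forall>x\<in>{0..pi}. (y has_vector_derivative y1 x) (at x within {0..pi})"
    and ac: "abs_cont_deriv y1 y2"
    and qp: "y pi = cis (pi * t) *s y 0" "y1 pi = cis (pi * t) *s y1 0"
    and ae: "AE x in lebesgue_on {0..pi}. ev *s y x = - y2 x + Q x *v y x"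
    using ef unfolding eigenfunction_def L_graph_def by blast
  have bl: "bounded_linear (\<lambda>v :: complex^'m. v $ i)" by (rule bounded_linear_vec_nth)
  have y2: "integrable (lebesgue_on {0..pi}) y2" using ac by (simp add: abs_cont_deriv_def)
  have y2i: "integrable (lebesgue_on {0..pi}) (\<lambda>x. y2 x $ i)"
    by (rule integrable_bounded_linear[OF bl y2])
  have ac1: "abs_cont_deriv (\<lambda>x. y1 x $ i) (\<lambda>x. y2 x $ i)"
    unfolding abs_cont_deriv_def
  proof (intro conjI ballI y2i)
    fix x :: real assume x: "x \<in> {0..pi}"
    then have "integrable (lebesgue_on {0..x}) y2" by (intro integrable_subinterval[OF y2]) auto
    then have "(LINT s|lebesgue_on {0..x}. y2 s $ i) = (LINT s|lebesgue_on {0..x}. y2 s) $ i"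
      by (rule integral_bounded_linear[OF bl])
    moreover have "y1 x = y1 0 + (LINT s|lebesgue_on {0..x}. y2 s)"
      using ac x unfolding abs_cont_deriv_def by blast
    ultimately show "y1 x $ i = y1 0 $ i + (LINT s|lebesgue_on {0..x}. y2 s $ i)"
      by (metis vector_add_component)
  qed
  have ac0: "abs_cont_deriv (\<lambda>x. y x $ i) (\<lambda>x. y1 x $ i)"
    using y abs_cont_continuous[OF ac1]
    by (intro abs_cont_deriv_of_vector_derivative)
      (auto intro: bounded_linear.has_vector_derivative[OF bl])
  note yc = eigenfunction_components(1)[OF ef]
  have Qyw: "integrable (lebesgue_on {0..pi}) (\<lambda>x. Q x $ i $ j * y x $ j * cnj (wave t n x))" for j
  proof -
    have "continuous_on {0..pi} (\<lambda>x. y x $ j * cnj (wave t n x))"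
      by (intro continuous_on_mult yc continuous_on_cnj continuous_on_wave)
    from L2_product(1)[OF Q this] show ?thesis by (simp add: mult.assoc)
  qed
  have yw: "integrable (lebesgue_on {0..pi}) (\<lambda>x. y x $ i * cnj (wave t n x))"
    by (intro integrable_on_0_pi continuous_on_mult yc continuous_on_cnj continuous_on_wave)
  have "wave_coeff t (\<lambda>x. y2 x $ i) n =
      (LINT x|lebesgue_on {0..pi}. (\<Sum>j\<in>UNIV. Q x $ i $ j * y x $ j * cnj (wave t n x))
        - ev * (y x $ i * cnj (wave t n x))) / pi"
    unfolding wave_coeff_def
  proof (intro arg_cong2[where f = "(/)"] refl integral_cong_AE)
    have "continuous_on {0..pi} (\<lambda>x. cnj (wave t n x))" by (intro continuous_intros)
    then show "(\<lambda>x. y2 x $ i * cnj (wave t n x)) \<in> borel_measurable (lebesgue_on {0..pi})"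
      using y2i integrable_on_0_pi borel_measurable_integrable by (intro borel_measurable_times) blast+
    show "(\<lambda>x. (\<Sum>j\<in>UNIV. Q x $ i $ j * y x $ j * cnj (wave t n x))
        - ev * (y x $ i * cnj (wave t n x))) \<in> borel_measurable (lebesgue_on {0..pi})"
      using Qyw yw by (intro borel_measurable_integrable) simp
    show "AE x in lebesgue_on {0..pi}. y2 x $ i * cnj (wave t n x) =
        (\<Sum>j\<in>UNIV. Q x $ i $ j * y x $ j * cnj (wave t n x)) - ev * (y x $ i * cnj (wave t n x))"
      using ae
    proof eventually_elim
      case (elim x)
      have "(ev *s y x) $ i = (- y2 x + Q x *v y x) $ i"
        by (rule arg_cong[OF elim])
      then have "ev * y x $ i = - y2 x $ i + (\<Sum>j\<in>UNIV. Q x $ i $ j * y x $ j)"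
        by (simp add: matrix_vector_mult_def)
      then have "y2 x $ i = (\<Sum>j\<in>UNIV. Q x $ i $ j * y x $ j) - ev * y x $ i"
        by (simp add: algebra_simps)
      then show ?case by (simp add: left_diff_distrib sum_distrib_right mult.assoc)
    qed
  qed
  also have "\<dots> = (\<Sum>j\<in>UNIV. wave_coeff t (\<lambda>x. Q x $ i $ j * y x $ j) n)
      - ev * wave_coeff t (\<lambda>x. y x $ i) n"
    unfolding wave_coeff_def using Qyw yw
    by (simp add: Bochner_Integration.integral_sum diff_divide_distrib sum_divide_distrib)
  finally have "(\<Sum>j\<in>UNIV. wave_coeff t (\<lambda>x. Q x $ i $ j * y x $ j) n) =
      ev * wave_coeff t (\<lambda>x. y x $ i) n + wave_coeff t (\<lambda>x. y2 x $ i) n" by simp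
  also have "wave_coeff t (\<lambda>x. y2 x $ i) n =
      (\<i> * (2 * of_int n + t))\<^sup>2 * wave_coeff t (\<lambda>x. y x $ i) n"
    using wave_coeff_derivative[OF ac1] wave_coeff_derivative[OF ac0] qp by (simp add: power2_eq_square)
  also have "(\<i> * (2 * of_int n + t))\<^sup>2 = - of_real ((2 * of_int n + t)\<^sup>2)"
    by (simp add: power_mult_distrib)
  finally show ?thesis by (simp add: left_diff_distrib)
qed

section \<open>Gaps between resonant and nonresonant indices\<close>
lemma ex_inverse_square_sum_bound:
  "\<exists>S\<ge>0. \<forall>F :: int set. finite F \<longrightarrow> (\<Sum>n\<in>F. 1 / (of_int n)\<^sup>2) \<le> (S :: real)"
proof -
  define g where "g j = 1 / (real j)\<^sup>2" for j :: nat
  have g: "summable g" unfolding g_def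
    using inverse_power_summable[of 2, where 'a = real] by (simp add: field_simps)
  have g0: "g j \<ge> 0" for j by (simp add: g_def)
  have half: "(\<Sum>n\<in>F. 1 / (of_int n)\<^sup>2) \<le> suminf g"
    if F: "finite F" "inj_on (\<lambda>n. nat \<bar>n\<bar>) F" for F :: "int set"
  proof -
    have "(\<Sum>n\<in>F. 1 / (of_int n)\<^sup>2) = (\<Sum>n\<in>F. g (nat \<bar>n\<bar>))"
      by (intro sum.cong) (auto simp: g_def)
    also have "\<dots> = (\<Sum>j\<in>(\<lambda>n. nat \<bar>n\<bar>) ` F. g j)" using F by (simp add: sum.reindex)
    also have "\<dots> \<le> suminf g" using F g g0 by (intro sum_le_suminf) auto
    finally show ?thesis .
  qed
  have "(\<Sum>n\<in>F. 1 / (of_int n)\<^sup>2) \<le> 2 * suminf g" if F: "finite F" for F :: "int set"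
  proof -
    have "(\<Sum>n\<in>F. 1 / (of_int n)\<^sup>2) =
        (\<Sum>n\<in>F \<inter> {0..}. 1 / (of_int n)\<^sup>2) + (\<Sum>n\<in>F - {0..}. 1 / (of_int n)\<^sup>2 :: real)"
      by (rule sum.Int_Diff[OF F])
    also have "\<dots> \<le> suminf g + suminf g"
      using F by (intro add_mono half) (auto simp: inj_on_def)
    finally show ?thesis by simp
  qed
  moreover have "suminf g \<ge> 0" using g g0 by (rule suminf_nonneg)
  ultimately show ?thesis by (intro exI[of _ "2 * suminf g"]) auto
qed

text \<open>The numbers \<open>a\<close> and \<open>b\<close> satisfy \<open>a \<ge> 1\<close> and \<open>b \<ge> \<beta>\<close>, with \<open>\<beta> = 1/3\<close> in the middle range of \<open>|t|\<close> and
\<open>\<beta> = 2/3\<close> otherwise, since the index set removes exactly the \<open>n\<close> for which \<open>n + k + t\<close> is smaller. The product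
is bounded below by expanding \<open>(a - 1)(b - \<beta>) \<ge> 0\<close> and using \<open>a + b \<ge> |2k + t|\<close>.\<close>
lemma nonresonant_gap:
  fixes k n :: int and t :: real
  assumes k: "\<bar>k\<bar> > 1" and t: "t \<in> {-1<..1}" and n: "n \<notin> index_set k t"
  defines "a \<equiv> \<bar>real_of_int (n - k)\<bar>" and "b \<equiv> \<bar>real_of_int (n + k) + t\<bar>"
  shows "a \<ge> 1" "b \<ge> 1/3" "a + b \<ge> \<bar>real_of_int k\<bar>" "4 * (a * b) \<ge> 4/3 * (2 * real_of_int \<bar>k\<bar> - 1)"
proof -
  have "n \<noteq> k" using n unfolding index_set_def by (auto split: if_splits)
  then show a: "a \<ge> 1" unfolding a_def by linarith
  have ab: "a + b \<ge> \<bar>2 * real_of_int k + t\<bar>" unfolding a_def b_def by simp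
  have k2: "real_of_int \<bar>k\<bar> \<ge> 2" using k by linarith
  then show "a + b \<ge> \<bar>real_of_int k\<bar>" using ab t by auto
  have "b \<ge> 1/3 \<and> a * b \<ge> (2 * real_of_int \<bar>k\<bar> - 1) / 3"
  proof (cases "1/3 \<le> \<bar>t\<bar> \<and> \<bar>t\<bar> \<le> 2/3")
    case True
    have b: "b \<ge> 1/3"
    proof (cases "n + k \<ge> 1 \<or> n + k \<le> -1")
      case True
      then have "real_of_int (n + k) \<ge> 1 \<or> real_of_int (n + k) \<le> -1" by linarith
      then show ?thesis unfolding b_def using \<open>1/3 \<le> \<bar>t\<bar> \<and> \<bar>t\<bar> \<le> 2/3\<close> by linarith
    next
      case False
      then have "n + k = 0" by linarith
      then show ?thesis unfolding b_def using True by simp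
    qed
    have "0 \<le> (a - 1) * (b - 1/3)" using a b by simp
    then have "a * b \<ge> a / 3 + b - 1/3" by (simp add: field_simps)
    moreover have "a + b \<ge> 2 * real_of_int \<bar>k\<bar> - 2/3"
      unfolding of_int_abs using ab True by linarith
    ultimately show ?thesis using b by (intro conjI) (simp_all add: field_simps)
  next
    case False
    have b: "b \<ge> 2/3"
    proof -
      consider "\<bar>t\<bar> < 1/3" "n + k \<noteq> 0" | "t > 2/3" "n + k \<noteq> -1" | "t < -2/3" "n + k \<noteq> 1"
        using False n t unfolding index_set_def by (auto split: if_splits)
      then show ?thesis
      proof cases
        case 1
        then have "real_of_int (n + k) \<ge> 1 \<or> real_of_int (n + k) \<le> -1" by linarith
        then show ?thesis unfolding b_def using 1 by linarith
      next
        case 2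
        then have "real_of_int (n + k) \<ge> 0 \<or> real_of_int (n + k) \<le> -2" by linarith
        then show ?thesis unfolding b_def using 2 t by auto
      next
        case 3
        then have "real_of_int (n + k) \<le> 0 \<or> real_of_int (n + k) \<ge> 2" by linarith
        then show ?thesis unfolding b_def using 3 t by auto
      qed
    qed
    have "0 \<le> (a - 1) * (b - 2/3)" using a b by simp
    then have "a * b \<ge> 2 * a / 3 + b - 2/3" by (simp add: field_simps)
    moreover have "a + b \<ge> 2 * real_of_int \<bar>k\<bar> - 1" using ab t by auto
    ultimately show ?thesis using b k2 by simp
  qed
  then show "b \<ge> 1/3" "4 * (a * b) \<ge> 4/3 * (2 * real_of_int \<bar>k\<bar> - 1)" by simp_all
qed

lemma square_gap:
  "(2 * real_of_int n + t)\<^sup>2 - (2 * real_of_int k + t)\<^sup>2 =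
    4 * (real_of_int (n - k) * (real_of_int (n + k) + t))"
  by (simp add: power2_eq_square algebra_simps)

text \<open>By partial fractions \<open>1/(ab) = (1/a + 1/b)/(a + b)\<close> with \<open>a + b \<ge> |k|\<close>, which produces the factor
\<open>1/k\<^sup>2\<close> and leaves two sums of inverse squares over shifted integers.\<close>
lemma ex_inverse_gap_square_sum_bound:
  "\<exists>T\<ge>0. \<forall>k t F. \<bar>k\<bar> > 1 \<and> t \<in> {-1<..1} \<and> finite F \<and> F \<inter> index_set k t = {} \<longrightarrow>
    (\<Sum>n\<in>F. 1 / (real_of_int (n - k) * (real_of_int (n + k) + t))\<^sup>2) \<le> T / (real_of_int k)\<^sup>2"
proof -
  obtain S where S0: "S \<ge> 0" and S: "\<And>F :: int set. finite F \<Longrightarrow> (\<Sum>n\<in>F. 1 / (of_int n)\<^sup>2) \<le> (S :: real)"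
    using ex_inverse_square_sum_bound by blast
  have "(\<Sum>n\<in>F. 1 / (real_of_int (n - k) * (real_of_int (n + k) + t))\<^sup>2) \<le> (2 * (17 * S + 9)) / (real_of_int k)\<^sup>2"
    if k: "\<bar>k\<bar> > 1" and t: "t \<in> {-1<..1}" and F: "finite F" and FA: "F \<inter> index_set k t = {}" for k t F
  proof -
    have bnd: "1 / (real_of_int (n - k) * (real_of_int (n + k) + t))\<^sup>2 \<le>
        2 / (real_of_int k)\<^sup>2 * (1 / (real_of_int (n - k))\<^sup>2
          + (16 * (1 / (real_of_int (n + k))\<^sup>2) + (if n = - k then 9 else 0)))" if "n \<in> F" for n
    proof -
      define a b where "a = \<bar>real_of_int (n - k)\<bar>" and "b = \<bar>real_of_int (n + k) + t\<bar>"
      have n: "n \<notin> index_set k t" using that FA by blast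
      note gap = nonresonant_gap[OF k t n, folded a_def b_def]
      have K: "\<bar>real_of_int k\<bar> > 0" using k by linarith
      have ab: "a > 0" "b > 0" using gap by linarith+
      have "1 / (a * b) * (a + b) = 1 / a + 1 / b" using ab by (simp add: field_simps)
      then have "1 / (a * b) = (1 / a + 1 / b) / (a + b)" using ab by (simp add: eq_divide_eq)
      also have "\<dots> \<le> (1 / a + 1 / b) / \<bar>real_of_int k\<bar>"
        using gap ab K by (intro divide_left_mono) auto
      finally have "(1 / (a * b))\<^sup>2 \<le> ((1 / a + 1 / b) / \<bar>real_of_int k\<bar>)\<^sup>2"
        using ab by (intro power_mono) auto
      also have "\<dots> = (1 / a + 1 / b)\<^sup>2 / (real_of_int k)\<^sup>2" by (simp add: power_divide)
      also have "\<dots> \<le> (2 * (1 / a\<^sup>2 + 1 / b\<^sup>2)) / (real_of_int k)\<^sup>2"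
        using sum_squares_bound[of "1 / a" "1 / b"]
        by (intro divide_right_mono) (auto simp: power2_sum power_divide)
      also have "1 / b\<^sup>2 \<le> 16 * (1 / (real_of_int (n + k))\<^sup>2) + (if n = - k then 9 else 0)"
      proof (cases "n = - k")
        case True
        have "1 / b\<^sup>2 \<le> 1 / (1/3)\<^sup>2" using gap(2) by (intro divide_left_mono power_mono) auto
        then show ?thesis using True by (simp add: power_divide)
      next
        case False
        \<comment> \<open>\<open>b \<ge> 1/3\<close> gives \<open>b + 1 \<le> 4b\<close>, which absorbs the shift by \<open>t\<close>\<close>
        define N where "N = \<bar>real_of_int (n + k)\<bar>"
        have "N \<ge> 1" unfolding N_def using False by linarith
        moreover have "N \<le> b + 1" unfolding b_def N_def using t by auto
        ultimately have N: "N / 4 \<le> b" "N / 4 > 0" using gap(2) by auto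
        then have "1 / b\<^sup>2 \<le> 1 / (N / 4)\<^sup>2"
          using ab by (intro divide_left_mono power_mono mult_pos_pos zero_less_power) auto
        then show ?thesis using False by (simp add: power_divide N_def)
      qed
      finally have "(1 / (a * b))\<^sup>2 \<le> 2 * (1 / a\<^sup>2 + (16 * (1 / (real_of_int (n + k))\<^sup>2) + (if n = - k then 9 else 0))) / (real_of_int k)\<^sup>2"
        by (auto simp: divide_right_mono)
      moreover have "(1 / (a * b))\<^sup>2 = 1 / (real_of_int (n - k) * (real_of_int (n + k) + t))\<^sup>2"
        "a\<^sup>2 = (real_of_int (n - k))\<^sup>2"
        unfolding a_def b_def by (simp_all add: power_divide power_mult_distrib)
      ultimately show ?thesis by simp
    qed
    have shift: "(\<Sum>n\<in>F. 1 / (real_of_int (n + d))\<^sup>2) \<le> S" for d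
    proof -
      have "(\<Sum>n\<in>F. 1 / (real_of_int (n + d))\<^sup>2) = (\<Sum>n\<in>(\<lambda>n. n + d) ` F. 1 / (real_of_int n)\<^sup>2)"
        by (simp add: sum.reindex)
      then show ?thesis using S F by (metis finite_imageI)
    qed
    have nine: "(\<Sum>n\<in>F. if n = - k then 9 else 0) \<le> (9 :: real)" using F by simp
    note sum_mono[OF bnd]
    also have "(\<Sum>n\<in>F. 2 / (real_of_int k)\<^sup>2 * (1 / (real_of_int (n - k))\<^sup>2
          + (16 * (1 / (real_of_int (n + k))\<^sup>2) + (if n = - k then 9 else 0)))) =
        2 / (real_of_int k)\<^sup>2 * ((\<Sum>n\<in>F. 1 / (real_of_int (n - k))\<^sup>2)
          + (16 * (\<Sum>n\<in>F. 1 / (real_of_int (n + k))\<^sup>2) + (\<Sum>n\<in>F. if n = - k then 9 else 0)))"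
      by (simp only: sum_distrib_left[symmetric] sum.distrib)
    also have "\<dots> \<le> 2 / (real_of_int k)\<^sup>2 * (S + (16 * S + 9))"
      using shift[of "-k"] shift[of k] nine by (intro mult_left_mono add_mono) auto
    finally show ?thesis by simp
  qed
  then show ?thesis using S0 by (intro exI[of _ "2 * (17 * S + 9)"]) auto
qed

lemma index_set_diff_cases:
  assumes "n \<in> index_set k t" "l \<in> index_set k t" "l \<noteq> n"
  shows "n - l \<in> {2*k, -(2*k), 2*k+1, -(2*k+1), 2*k-1, -(2*k-1)}"
  using assms unfolding index_set_def by (auto split: if_splits)

lemma index_set_basics: "finite (index_set k t)" "card (index_set k t) \<le> 2" "k \<in> index_set k t"
  unfolding index_set_def by (auto simp: card_insert_if)

section \<open>The potential in the basis of waves\<close>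

lemma finite_q_max_set:
  fixes Q :: "real \<Rightarrow> complex^'m^'m"
  shows "finite {cmod (fourier_coeff Q i j s) | i j s.
    s \<in> {2*k, -(2*k), 2*k+1, -(2*k+1), 2*k-1, -(2*k-1)}}"
proof -
  define Z where "Z = {2*k, -(2*k), 2*k+1, -(2*k+1), 2*k-1, -(2*k-1)}"
  have "{cmod (fourier_coeff Q i j s) | i j s. s \<in> Z} =
      (\<lambda>(i, j, s). cmod (fourier_coeff Q i j s)) ` (UNIV \<times> UNIV \<times> Z)" by force
  then show ?thesis unfolding Z_def[symmetric] by (simp add: Z_def)
qed

lemma q_max_upper:
  fixes Q :: "real \<Rightarrow> complex^'m^'m"
  assumes "s \<in> {2*k, -(2*k), 2*k+1, -(2*k+1), 2*k-1, -(2*k-1)}"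
  shows "cmod (fourier_coeff Q i j s) \<le> q_max Q k"
  unfolding q_max_def using assms by (intro Max_ge[OF finite_q_max_set]) blast

lemma q_max_attained:
  fixes Q :: "real \<Rightarrow> complex^'m^'m"
  shows "\<exists>i j s. q_max Q k = cmod (fourier_coeff Q i j s)"
proof -
  have "q_max Q k \<in> {cmod (fourier_coeff Q i j s) | i j s.
      s \<in> {2*k, -(2*k), 2*k+1, -(2*k+1), 2*k-1, -(2*k-1)}}"
    unfolding q_max_def by (intro Max_in[OF finite_q_max_set]) blast
  then show ?thesis by blast
qed

lemma q_max_nonneg: "q_max Q k \<ge> 0"
  using q_max_attained[of Q k] by force

lemma wave_coeff_mult_wave:
  "wave_coeff t (\<lambda>x. Q x $ i $ j * wave t l x) n = fourier_coeff Q i j (n - l) / of_real (sqrt pi)"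
proof -
  have eq: "Q x $ i $ j * wave t l x * cnj (wave t n x) =
      Q x $ i $ j * exp (- 2 * \<i> * of_int (n - l) * of_real x)" for x
    unfolding mult.assoc wave_cnj_wave cis_conv_exp
    by (rule arg_cong2[where f = "(*)"], rule refl, rule arg_cong[where f = exp])
      (simp add: algebra_simps)
  have "complex_of_real pi = of_real (sqrt pi) * of_real (sqrt pi)"
    by (simp flip: of_real_mult)
  then show ?thesis unfolding wave_coeff_def fourier_coeff_def eq by simp
qed

lemma wave_coeff_mult_wave_same:
  "wave_coeff t (\<lambda>x. Q x $ i $ j * wave t n x) n = mean_matrix Q $ i $ j"
proof -
  have eq: "Q x $ i $ j * wave t n x * cnj (wave t n x) = Q x $ i $ j" for x
    unfolding mult.assoc wave_cnj_wave by simp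
  show ?thesis unfolding wave_coeff_def mean_matrix_def eq by simp
qed

text \<open>One constant for all entries of \<open>Q\<close>, so that it can be chosen before \<open>k\<close>, \<open>t\<close> and the eigenfunction.\<close>
lemma ex_L2_product_coeff_bound:
  fixes Q :: "real \<Rightarrow> complex^'m^'m"
  assumes Q: "\<And>i j. L2_on {0..pi} (\<lambda>x. Q x $ i $ j)"
  shows "\<exists>H>0. \<forall>i j g D t n. continuous_on {0..pi} g \<and> 0 \<le> D \<and>
      (LINT x|lebesgue_on {0..pi}. (cmod (g x))\<^sup>2) \<le> D\<^sup>2 \<longrightarrow>
      cmod (wave_coeff t (\<lambda>x. Q x $ i $ j * g x) n) \<le> D * H"
proof -
  define h where "h i j = ((LINT x|lebesgue_on {0..pi}. (cmod (Q x $ i $ j))\<^sup>2) + 1) / (2 * pi)" for i j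
  have h: "h i j > 0" for i j
    unfolding h_def by (intro divide_pos_pos add_nonneg_pos integral_nonneg_AE) auto
  then have h0: "h i j \<ge> 0" for i j by (rule less_imp_le)
  define H where "H = (\<Sum>i\<in>UNIV. \<Sum>j\<in>UNIV. h i j)"
  have hH: "h i j \<le> H" for i j
  proof -
    have "h i j \<le> (\<Sum>j\<in>UNIV. h i j)" using h0 by (intro member_le_sum) auto
    also have "\<dots> \<le> H" unfolding H_def
      using h0 by (intro member_le_sum) (auto intro!: sum_nonneg)
    finally show ?thesis .
  qed
  have "cmod (wave_coeff t (\<lambda>x. Q x $ i $ j * g x) n) \<le> D * H"
    if g: "continuous_on {0..pi} g" "0 \<le> D" "(LINT x|lebesgue_on {0..pi}. (cmod (g x))\<^sup>2) \<le> D\<^sup>2"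
    for i j g D t n
  proof -
    have "cmod (wave_coeff t (\<lambda>x. Q x $ i $ j * g x) n) \<le> D * h i j"
      using norm_wave_coeff_L2_product_le[OF Q g] by (simp add: h_def)
    also have "\<dots> \<le> D * H" using hH g by (intro mult_left_mono) auto
    finally show ?thesis .
  qed
  moreover have "H > 0" using h hH less_le_trans by blast
  ultimately show ?thesis by blast
qed

lemma ex_q_max_bound:
  fixes Q :: "real \<Rightarrow> complex^'m^'m"
  assumes Q: "\<And>i j. L2_on {0..pi} (\<lambda>x. Q x $ i $ j)"
  shows "\<exists>R. \<forall>k. q_max Q k \<le> R"
proof -
  obtain H where H: "\<And>i j g D t n. continuous_on {0..pi} g \<Longrightarrow> 0 \<le> D \<Longrightarrow>
      (LINT x|lebesgue_on {0..pi}. (cmod (g x))\<^sup>2) \<le> D\<^sup>2 \<Longrightarrow>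
      cmod (wave_coeff t (\<lambda>x. Q x $ i $ j * g x) n) \<le> D * H"
    using ex_L2_product_coeff_bound[OF Q] by blast
  have "cmod (fourier_coeff Q i j s) \<le> sqrt pi * (sqrt pi * H)" for i j s
  proof -
    have "cmod (wave_coeff 0 (\<lambda>x. Q x $ i $ j * wave 0 0 x) s) \<le> sqrt pi * H"
      by (rule H) (auto simp: measure_restrict_space continuous_on_wave)
    then show ?thesis
      unfolding wave_coeff_mult_wave by (simp add: norm_divide field_simps)
  qed
  then show ?thesis using q_max_attained by metis
qed

section \<open>Eigenfunctions are almost resonant\<close>
lemma sq_integral_pos:
  fixes f :: "real \<Rightarrow> complex"
  assumes f: "continuous_on {0..pi} f" and x: "x \<in> {0..pi}" "f x \<noteq> 0"
  shows "(LINT x|lebesgue_on {0..pi}. (cmod (f x))\<^sup>2) > 0"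
proof (rule ccontr)
  assume "\<not> ?thesis"
  moreover have "(LINT x|lebesgue_on {0..pi}. (cmod (f x))\<^sup>2) \<ge> 0" by (rule integral_nonneg_AE) simp
  ultimately have "(LINT x|lebesgue_on {0..pi}. (cmod (f x))\<^sup>2) = 0" by linarith
  moreover have c: "continuous_on {0..pi} (\<lambda>x. (cmod (f x))\<^sup>2)" using f by (intro continuous_intros)
  ultimately have "integral {0..pi} (\<lambda>x. (cmod (f x))\<^sup>2) = 0"
    using lebesgue_integral_eq_integral[OF integrable_on_0_pi[OF c]] by simp
  then have "((\<lambda>x. (cmod (f x))\<^sup>2) has_integral 0) (cbox 0 pi)"
    using integrable_continuous_interval[OF c] by (metis box_real(2) integrable_integral)
  then have "(cmod (f x))\<^sup>2 = 0"
    using c x pi_gt_zero by (intro has_integral_0_cbox_imp_0[of 0 pi "\<lambda>x. (cmod (f x))\<^sup>2"]) (auto simp del: pi_gt_zero)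
  then show False using x by simp
qed

lemma eigenfunction_sq_integral_pos:
  fixes y :: "real \<Rightarrow> complex^'m"
  assumes "eigenfunction Q t ev y"
  shows "(\<Sum>i\<in>UNIV. LINT x|lebesgue_on {0..pi}. (cmod (y x $ i))\<^sup>2) > 0"
proof -
  obtain x where x: "x \<in> {0..pi}" "y x \<noteq> 0" using assms unfolding eigenfunction_def by blast
  then obtain i where i: "y x $ i \<noteq> 0" by (auto simp: Finite_Cartesian_Product.vec_eq_iff)
  have "(LINT x|lebesgue_on {0..pi}. (cmod (y x $ i))\<^sup>2) > 0"
    by (rule sq_integral_pos[OF eigenfunction_components(1)[OF assms] x(1) i])
  then show ?thesis
    by (intro sum_pos2[of _ i]) (auto intro: integral_nonneg_AE)
qed

lemma norm_vec_le_sum_norms: "norm (v :: complex^'m) \<le> (\<Sum>i\<in>UNIV. cmod (v $ i))"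
  unfolding norm_vec_def by (rule L2_set_le_sum) simp

text \<open>What is left of a component of \<open>y\<close> without its resonant waves satisfies the same quasiperiodic
condition, so completeness bounds it by its coefficients, and these are the nonresonant coefficients of \<open>y\<close>.\<close>
lemma ex_nonresonant_part_bound:
  fixes Q :: "real \<Rightarrow> complex^'m^'m"
  assumes Q: "\<And>i j. L2_on {0..pi} (\<lambda>x. Q x $ i $ j)"
  shows "\<exists>E>0. \<forall>k t ev y N i. \<bar>k\<bar> > 1 \<and> 4/3 * (2 * real_of_int \<bar>k\<bar> - 1) > 3 * c \<and> t \<in> {-1<..1} \<and>
      eigenfunction Q t ev y \<and> cmod (ev - of_real ((2 * of_int k + t)\<^sup>2)) < c \<and> 0 \<le> N \<and>
      (\<forall>i. (LINT x|lebesgue_on {0..pi}. (cmod (y x $ i))\<^sup>2) \<le> N\<^sup>2) \<longrightarrow>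
      (LINT x|lebesgue_on {0..pi}. (cmod (y x $ i -
        (\<Sum>l\<in>index_set k t. wave_coeff t (\<lambda>x. y x $ i) l * wave t l x)))\<^sup>2) \<le> (N * E / real_of_int \<bar>k\<bar>)\<^sup>2"
proof -
  obtain H where H0: "H > 0" and H: "\<And>i j g D t n. continuous_on {0..pi} g \<Longrightarrow> 0 \<le> D \<Longrightarrow>
      (LINT x|lebesgue_on {0..pi}. (cmod (g x))\<^sup>2) \<le> D\<^sup>2 \<Longrightarrow>
      cmod (wave_coeff t (\<lambda>x. Q x $ i $ j * g x) n) \<le> D * H"
    using ex_L2_product_coeff_bound[OF Q] by blast
  obtain T where T0: "T \<ge> 0" and T: "\<And>k t F. \<bar>k\<bar> > 1 \<Longrightarrow> t \<in> {-1<..1} \<Longrightarrow> finite F \<Longrightarrow> F \<inter> index_set k t = {} \<Longrightarrow>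
    (\<Sum>n\<in>F. 1 / (real_of_int (n - k) * (real_of_int (n + k) + t))\<^sup>2) \<le> T / (real_of_int k)\<^sup>2"
    using ex_inverse_gap_square_sum_bound by blast
  define m where "m = real CARD('m)"
  have m: "m > 0" unfolding m_def by simp
  define E where "E = m * H * sqrt (pi * T) + 1"
  have E0: "E > 0" unfolding E_def using m H0 T0 by (simp add: add_nonneg_pos)
  show ?thesis
  proof (intro exI[of _ E] conjI E0 allI impI)
    fix k t ev y N i
    assume A: "\<bar>k\<bar> > 1 \<and> 4/3 * (2 * real_of_int \<bar>k\<bar> - 1) > 3 * c \<and> t \<in> {-1<..1} \<and>
      eigenfunction Q t ev y \<and> cmod (ev - of_real ((2 * of_int k + t)\<^sup>2)) < c \<and> 0 \<le> N \<and>
      (\<forall>i. (LINT x|lebesgue_on {0..pi}. (cmod (y x $ i))\<^sup>2) \<le> N\<^sup>2)"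
    then have k: "\<bar>k\<bar> > 1" and sep: "4/3 * (2 * real_of_int \<bar>k\<bar> - 1) > 3 * c" and t: "t \<in> {-1<..1}"
      and ef: "eigenfunction Q t ev y" and ev: "cmod (ev - of_real ((2 * of_int k + t)\<^sup>2)) < c" and N: "0 \<le> N"
      and yN: "\<And>i. (LINT x|lebesgue_on {0..pi}. (cmod (y x $ i))\<^sup>2) \<le> N\<^sup>2" by auto
    note yc = eigenfunction_components(1)[OF ef]
    define cf where "cf n = wave_coeff t (\<lambda>x. y x $ i) n" for n
    define r where "r x = y x $ i - (\<Sum>l\<in>index_set k t. cf l * wave t l x)" for x
    have rc: "continuous_on {0..pi} r"
      unfolding r_def by (intro continuous_on_diff continuous_on_sum continuous_on_mult yc
          continuous_on_const continuous_on_wave)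
    have cr: "wave_coeff t r n = (if n \<in> index_set k t then 0 else cf n)" for n
      unfolding r_def using wave_coeff_diff_sum[OF yc index_set_basics(1)] by (simp add: cf_def)
    have wpi: "wave t l pi = cis (pi * t) * wave t l 0" for l
    proof -
      have "wave t l pi = cis (2 * of_int l * pi) * cis (pi * t)"
        unfolding wave_def cis_mult by (rule arg_cong[of _ _ cis]) (simp add: algebra_simps)
      then show ?thesis by (simp add: cis_2_int_pi wave_def)
    qed
    have rqp: "r pi = cis (pi * t) * r 0"
      unfolding r_def wpi eigenfunction_components(2)[OF ef]
      by (simp add: right_diff_distrib sum_distrib_left mult.left_commute)
    have out: "(cmod (cf n))\<^sup>2 \<le> (m * N * H)\<^sup>2 * (1 / (real_of_int (n - k) * (real_of_int (n + k) + t))\<^sup>2)"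
      if n: "n \<notin> index_set k t" for n
    proof -
      \<comment> \<open>\<open>4p\<close> is the distance of \<open>(2n + t)\<^sup>2\<close> and \<open>(2k + t)\<^sup>2\<close>, and the condition on \<open>k\<close> says \<open>4p > 3c\<close>,
        so that \<open>4p - c\<close> is more than \<open>p\<close>\<close>
      define p where "p = \<bar>real_of_int (n - k)\<bar> * \<bar>real_of_int (n + k) + t\<bar>"
      note gap = nonresonant_gap[OF k t n]
      have p4: "4 * p \<ge> 4/3 * (2 * real_of_int \<bar>k\<bar> - 1)" using gap(4) by (simp add: p_def)
      have p0: "p > 0" unfolding p_def using gap by (intro mult_pos_pos) linarith+
      have "cmod (of_real ((2 * of_int n + t)\<^sup>2) - of_real ((2 * of_int k + t)\<^sup>2)) = 4 * p"
        unfolding of_real_diff[symmetric] square_gap norm_of_real p_def by (simp add: abs_mult)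
      then have "4 * p \<le> cmod (ev - of_real ((2 * of_int n + t)\<^sup>2)) + cmod (ev - of_real ((2 * of_int k + t)\<^sup>2))"
        using norm_triangle_ineq4[of "ev - of_real ((2 * of_int k + t)\<^sup>2)" "ev - of_real ((2 * of_int n + t)\<^sup>2)"]
        by (simp add: add.commute)
      then have d: "p \<le> cmod (ev - of_real ((2 * of_int n + t)\<^sup>2))" using ev sep p4 p0 by linarith
      have "cmod ((ev - of_real ((2 * of_int n + t)\<^sup>2)) * cf n) \<le> m * N * H"
      proof -
        have "cmod ((ev - of_real ((2 * of_int n + t)\<^sup>2)) * cf n) \<le>
            (\<Sum>j\<in>UNIV. cmod (wave_coeff t (\<lambda>x. Q x $ i $ j * y x $ j) n))"
          unfolding cf_def eigenfunction_coeff_eq[OF ef Q] by (rule norm_sum)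
        also have "\<dots> \<le> (\<Sum>j\<in>(UNIV :: 'm set). N * H)"
          by (intro sum_mono H yc N yN)
        finally show ?thesis by (simp add: m_def mult.assoc)
      qed
      then have "p * cmod (cf n) \<le> m * N * H"
        using d mult_right_mono[OF d norm_ge_zero[of "cf n"]] by (simp add: norm_mult)
      then have "cmod (cf n) \<le> m * N * H * (1 / p)" using p0 by (simp add: field_simps)
      then have "(cmod (cf n))\<^sup>2 \<le> (m * N * H * (1 / p))\<^sup>2" by (intro power_mono) auto
      then show ?thesis by (simp add: power_mult_distrib power_divide p_def)
    qed
    have "(LINT x|lebesgue_on {0..pi}. (cmod (r x))\<^sup>2) \<le> pi * ((m * N * H)\<^sup>2 * (T / (real_of_int k)\<^sup>2))"
    proof (rule sq_integral_le_of_coeffs[OF rc rqp])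
      fix F :: "int set" assume F: "finite F"
      let ?F = "F - index_set k t"
      have "(\<Sum>n\<in>F. (cmod (wave_coeff t r n))\<^sup>2) = (\<Sum>n\<in>?F. (cmod (cf n))\<^sup>2)"
        using F by (intro sum.mono_neutral_cong_right) (auto simp: cr)
      also have "\<dots> \<le> (\<Sum>n\<in>?F. (m * N * H)\<^sup>2 * (1 / (real_of_int (n - k) * (real_of_int (n + k) + t))\<^sup>2))"
        by (intro sum_mono out) auto
      also have "\<dots> = (m * N * H)\<^sup>2 * (\<Sum>n\<in>?F. 1 / (real_of_int (n - k) * (real_of_int (n + k) + t))\<^sup>2)"
        by (simp only: sum_distrib_left)
      also have "\<dots> \<le> (m * N * H)\<^sup>2 * (T / (real_of_int k)\<^sup>2)"
        using F by (intro mult_left_mono T k t) auto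
      finally show "(\<Sum>n\<in>F. (cmod (wave_coeff t r n))\<^sup>2) \<le> (m * N * H)\<^sup>2 * (T / (real_of_int k)\<^sup>2)" .
    qed
    also have "\<dots> = (N * (m * H * sqrt (pi * T)) / real_of_int \<bar>k\<bar>)\<^sup>2"
      using T0 by (simp add: power_mult_distrib power_divide real_sqrt_pow2)
    also have "\<dots> \<le> (N * E / real_of_int \<bar>k\<bar>)\<^sup>2"
      unfolding E_def using N m H0 T0
      by (intro power_mono divide_right_mono mult_left_mono) auto
    finally show "(LINT x|lebesgue_on {0..pi}. (cmod (y x $ i -
        (\<Sum>l\<in>index_set k t. wave_coeff t (\<lambda>x. y x $ i) l * wave t l x)))\<^sup>2) \<le> (N * E / real_of_int \<bar>k\<bar>)\<^sup>2"
      unfolding r_def cf_def .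
  qed
qed

text \<open>A resonant coefficient vector of sufficiently large norm is an approximate eigenvector of the mean matrix. Two
estimates meet here: Pythagoras' theorem makes that vector comparable to \<open>y\<close> once \<open>|k|\<close> exceeds a constant \<open>K\<close>,
and splitting \<open>y\<close> into its resonant waves and the remainder \<open>r\<close> bounds the error in the resonant equation.\<close>
lemma ex_quasi_eigenvector:
  fixes Q :: "real \<Rightarrow> complex^'m^'m"
  assumes Q: "\<And>i j. L2_on {0..pi} (\<lambda>x. Q x $ i $ j)"
  shows "\<exists>C K. C \<ge> 1 \<and> K \<ge> 0 \<and> (\<forall>k t ev. \<bar>k\<bar> > 1 \<and> 4/3 * (2 * real_of_int \<bar>k\<bar> - 1) > 3 * c \<and>
      t \<in> {-1<..1} \<and> ev \<in> L_eigenvalues Q t \<and> cmod (ev - of_real ((2 * of_int k + t)\<^sup>2)) < c \<and>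
      real_of_int \<bar>k\<bar> > K \<longrightarrow>
      (\<exists>n\<in>index_set k t. \<exists>v. v \<noteq> 0 \<and>
        norm (mean_matrix Q *v v - (ev - of_real ((2 * of_int n + t)\<^sup>2)) *s v) \<le>
          C * (1 / real_of_int \<bar>k\<bar> + q_max Q k) * norm v))"
proof -
  obtain H where H0: "H > 0" and H: "\<And>i j g D t n. continuous_on {0..pi} g \<Longrightarrow> 0 \<le> D \<Longrightarrow>
      (LINT x|lebesgue_on {0..pi}. (cmod (g x))\<^sup>2) \<le> D\<^sup>2 \<Longrightarrow>
      cmod (wave_coeff t (\<lambda>x. Q x $ i $ j * g x) n) \<le> D * H"
    using ex_L2_product_coeff_bound[OF Q] by blast
  obtain E where E0: "E > 0" and E: "\<And>k t ev y N i. \<bar>k\<bar> > 1 \<Longrightarrow> 4/3 * (2 * real_of_int \<bar>k\<bar> - 1) > 3 * c \<Longrightarrow>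
      t \<in> {-1<..1} \<Longrightarrow> eigenfunction Q t ev y \<Longrightarrow> cmod (ev - of_real ((2 * of_int k + t)\<^sup>2)) < c \<Longrightarrow> 0 \<le> N \<Longrightarrow>
      (\<And>i. (LINT x|lebesgue_on {0..pi}. (cmod (y x $ i))\<^sup>2) \<le> N\<^sup>2) \<Longrightarrow>
      (LINT x|lebesgue_on {0..pi}. (cmod (y x $ i -
        (\<Sum>l\<in>index_set k t. wave_coeff t (\<lambda>x. y x $ i) l * wave t l x)))\<^sup>2) \<le> (N * E / real_of_int \<bar>k\<bar>)\<^sup>2"
    using ex_nonresonant_part_bound[OF Q, of c] by blast
  define m where "m = real CARD('m)"
  have m: "m \<ge> 1" unfolding m_def by (simp add: Suc_le_eq)
  define C where "C = 4 * m * m * (2 + E * H)"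
  define K where "K = 2 * m * E\<^sup>2 + 1"
  have "1 * 1 \<le> m * m" using m by (intro mult_mono) auto
  then have "1 * 1 \<le> (4 * (m * m)) * (2 + E * H)" using E0 H0 by (intro mult_mono) auto
  then have C1: "C \<ge> 1" unfolding C_def by (simp add: mult.assoc)
  have K0: "K \<ge> 0" unfolding K_def using m by simp
  have main: "\<exists>n\<in>index_set k t. \<exists>v. v \<noteq> 0 \<and>
        norm (mean_matrix Q *v v - (ev - of_real ((2 * of_int n + t)\<^sup>2)) *s v) \<le>
          C * (1 / real_of_int \<bar>k\<bar> + q_max Q k) * norm v"
    if k: "\<bar>k\<bar> > 1" and sep: "4/3 * (2 * real_of_int \<bar>k\<bar> - 1) > 3 * c" and t: "t \<in> {-1<..1}"
      and eig: "ev \<in> L_eigenvalues Q t" and ev: "cmod (ev - of_real ((2 * of_int k + t)\<^sup>2)) < c"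
      and kK: "real_of_int \<bar>k\<bar> > K" for k t ev
  proof -
    obtain y where ef: "eigenfunction Q t ev y" using eig unfolding L_eigenvalues_def by blast
    note yc = eigenfunction_components(1)[OF ef]
    define \<kappa> where "\<kappa> = real_of_int \<bar>k\<bar>"
    have \<kappa>: "\<kappa> > 1" unfolding \<kappa>_def using k by linarith
    let ?A = "index_set k t"
    define Y where "Y i = (LINT x|lebesgue_on {0..pi}. (cmod (y x $ i))\<^sup>2)" for i
    define N where "N = sqrt (\<Sum>i\<in>UNIV. Y i)"
    have Y0: "Y i \<ge> 0" for i unfolding Y_def by (rule integral_nonneg_AE) simp
    have N0: "N > 0" and N2: "N\<^sup>2 = (\<Sum>i\<in>UNIV. Y i)"
      unfolding N_def using eigenfunction_sq_integral_pos[OF ef] by (simp_all add: Y_def[symmetric])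
    have YN: "Y i \<le> N\<^sup>2" for i unfolding N2 using Y0 by (intro member_le_sum) auto
    define cf where "cf n = (\<chi> i. wave_coeff t (\<lambda>x. y x $ i) n)" for n
    define r where "r i x = y x $ i - (\<Sum>l\<in>?A. cf l $ i * wave t l x)" for i x
    define D where "D = N * E / \<kappa>"
    have D0: "D \<ge> 0" unfolding D_def using N0 E0 \<kappa> by simp
    have rc: "continuous_on {0..pi} (r i)" for i
      unfolding r_def by (intro continuous_on_diff continuous_on_sum continuous_on_mult yc
          continuous_on_const continuous_on_wave)
    have rD: "(LINT x|lebesgue_on {0..pi}. (cmod (r i x))\<^sup>2) \<le> D\<^sup>2" for i
      using E[OF k sep t ef ev less_imp_le[OF N0] YN[unfolded Y_def], of i]
      by (simp add: r_def cf_def D_def \<kappa>_def)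
    have pyth: "(LINT x|lebesgue_on {0..pi}. (cmod (r i x))\<^sup>2) = Y i - pi * (\<Sum>l\<in>?A. (cmod (cf l $ i))\<^sup>2)" for i
      unfolding r_def sq_integral_diff_sum[OF yc index_set_basics(1)] by (simp add: Y_def cf_def sum_negf)
    have cfN: "cmod (cf l $ i) \<le> N" for l i
    proof -
      have "pi * (\<Sum>l\<in>{l}. (cmod (cf l $ i))\<^sup>2) \<le> Y i"
        unfolding cf_def Y_def vec_lambda_beta by (rule bessel_inequality[OF yc]) simp
      moreover have "1 * (cmod (cf l $ i))\<^sup>2 \<le> pi * (cmod (cf l $ i))\<^sup>2"
        using pi_gt3 by (intro mult_right_mono) auto
      ultimately have "(cmod (cf l $ i))\<^sup>2 \<le> N\<^sup>2" using YN[of i] by simp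
      then show ?thesis using N0 by (simp add: power2_le_iff_abs_le)
    qed
    \<comment> \<open>the at most two resonant waves carry half of \<open>N\<^sup>2\<close>, so one of them has \<open>\<pi>|c\<^sub>n|\<^sup>2 \<ge> N\<^sup>2/4\<close>; and \<open>4\<pi> \<le> 16\<close>\<close>
    obtain n where n: "n \<in> ?A" and big: "N \<le> 4 * norm (cf n)"
    proof -
      have "(\<Sum>i\<in>UNIV. Y i - pi * (\<Sum>l\<in>?A. (cmod (cf l $ i))\<^sup>2)) \<le> (\<Sum>i\<in>(UNIV :: 'm set). D\<^sup>2)"
        unfolding pyth[symmetric] by (intro sum_mono rD)
      then have "N\<^sup>2 - pi * (\<Sum>i\<in>UNIV. \<Sum>l\<in>?A. (cmod (cf l $ i))\<^sup>2) \<le> m * D\<^sup>2"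
        by (simp add: sum_subtractf N2 m_def sum_distrib_left)
      also have "(\<Sum>i\<in>UNIV. \<Sum>l\<in>?A. (cmod (cf l $ i))\<^sup>2) = (\<Sum>l\<in>?A. (norm (cf l))\<^sup>2)"
        by (subst sum.swap) (simp add: norm_vec_def L2_set_def sum_nonneg)
      also have "m * D\<^sup>2 \<le> N\<^sup>2 / 2"
      proof -
        have "2 * m * E\<^sup>2 \<le> \<kappa> * 1" using kK by (simp add: K_def \<kappa>_def)
        also have "\<dots> \<le> \<kappa> * \<kappa>" using \<kappa> by (intro mult_left_mono) auto
        finally have "N\<^sup>2 * (2 * m * E\<^sup>2) \<le> N\<^sup>2 * (\<kappa> * \<kappa>)" by (intro mult_left_mono) auto
        then show ?thesis unfolding D_def using \<kappa>
          by (simp add: power_divide power_mult_distrib field_simps power2_eq_square)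
      qed
      finally have sum: "N\<^sup>2 / 2 \<le> pi * (\<Sum>l\<in>?A. (norm (cf l))\<^sup>2)" by simp
      have "\<exists>n\<in>?A. N\<^sup>2 \<le> 16 * (norm (cf n))\<^sup>2"
      proof (rule ccontr)
        assume "\<not> ?thesis"
        then have "(norm (cf l))\<^sup>2 \<le> N\<^sup>2 / 16" if "l \<in> ?A" for l using that by force
        then have "(\<Sum>l\<in>?A. (norm (cf l))\<^sup>2) \<le> of_nat (card ?A) * (N\<^sup>2 / 16)"
          by (rule sum_bounded_above)
        also have "\<dots> \<le> 2 * (N\<^sup>2 / 16)"
          using index_set_basics(2)[of k t] by (intro mult_right_mono) auto
        finally have "pi * (\<Sum>l\<in>?A. (norm (cf l))\<^sup>2) \<le> pi * (N\<^sup>2 / 8)" by simp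
        also have "\<dots> < 4 * (N\<^sup>2 / 8)" using pi_less_4 N0 by (intro mult_strict_right_mono) auto
        finally show False using sum by simp
      qed
      then obtain n where n: "n \<in> ?A" "N\<^sup>2 \<le> 16 * (norm (cf n))\<^sup>2" by blast
      then have "N\<^sup>2 \<le> (4 * norm (cf n))\<^sup>2" by (simp add: power_mult_distrib)
      then have "N \<le> 4 * norm (cf n)" by (rule power2_le_imp_le) simp
      with n(1) show ?thesis by (rule that)
    qed
    define z where "z = ev - of_real ((2 * of_int n + t)\<^sup>2)"
    have q0: "q_max Q k \<ge> 0"
      by (rule q_max_nonneg)
    \<comment> \<open>the wave \<open>n\<close> sees the mean of \<open>Q\<close>; the other resonant wave and \<open>r\<close> form the error\<close>
    have split: "wave_coeff t (\<lambda>x. Q x $ i $ j * y x $ j) n = mean_matrix Q $ i $ j * cf n $ j +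
        (\<Sum>l\<in>?A - {n}. cf l $ j * wave_coeff t (\<lambda>x. Q x $ i $ j * wave t l x) n)
        + wave_coeff t (\<lambda>x. Q x $ i $ j * r j x) n" for i j
    proof -
      have int: "integrable (lebesgue_on {0..pi}) (\<lambda>x. Q x $ i $ j * g x * cnj (wave t n x))"
        if "continuous_on {0..pi} g" for g
      proof -
        have "continuous_on {0..pi} (\<lambda>x. g x * cnj (wave t n x))"
          by (intro continuous_on_mult that continuous_on_cnj continuous_on_wave)
        from L2_product(1)[OF Q this] show ?thesis by (simp add: mult.assoc)
      qed
      have "Q x $ i $ j * y x $ j * cnj (wave t n x) =
          (\<Sum>l\<in>?A. cf l $ j * (Q x $ i $ j * wave t l x * cnj (wave t n x)))
          + Q x $ i $ j * r j x * cnj (wave t n x)" for x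
        unfolding r_def by (simp add: algebra_simps sum_distrib_left)
      then have "wave_coeff t (\<lambda>x. Q x $ i $ j * y x $ j) n =
          (\<Sum>l\<in>?A. cf l $ j * wave_coeff t (\<lambda>x. Q x $ i $ j * wave t l x) n)
          + wave_coeff t (\<lambda>x. Q x $ i $ j * r j x) n"
        unfolding wave_coeff_def using int[OF continuous_on_wave] int[OF rc[of j]]
        by (simp add: Bochner_Integration.integral_sum add_divide_distrib sum_divide_distrib)
      then show ?thesis
        unfolding sum.remove[OF index_set_basics(1) n] wave_coeff_mult_wave_same by (simp add: mult.commute)
    qed
    define err where "err i j = (\<Sum>l\<in>?A - {n}. cf l $ j * wave_coeff t (\<lambda>x. Q x $ i $ j * wave t l x) n)
        + wave_coeff t (\<lambda>x. Q x $ i $ j * r j x) n" for i j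
    have err: "cmod (err i j) \<le> N * (2 + E * H) * (1 / \<kappa> + q_max Q k)" for i j
    proof -
      have "cmod (cf l $ j * wave_coeff t (\<lambda>x. Q x $ i $ j * wave t l x) n) \<le> N * q_max Q k"
        if l: "l \<in> ?A - {n}" for l
      proof -
        have "cmod (wave_coeff t (\<lambda>x. Q x $ i $ j * wave t l x) n) =
            cmod (fourier_coeff Q i j (n - l)) / sqrt pi"
          unfolding wave_coeff_mult_wave by (simp add: norm_divide)
        also have "\<dots> \<le> cmod (fourier_coeff Q i j (n - l)) / 1"
          using pi_gt3 by (intro divide_left_mono) auto
        also have "\<dots> \<le> q_max Q k"
          using q_max_upper[OF index_set_diff_cases[OF n, of l]] l by simp
        finally show ?thesis unfolding norm_mult using cfN N0 by (intro mult_mono) auto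
      qed
      then have "cmod (\<Sum>l\<in>?A - {n}. cf l $ j * wave_coeff t (\<lambda>x. Q x $ i $ j * wave t l x) n) \<le>
          (\<Sum>l\<in>?A - {n}. N * q_max Q k)"
        by (intro order_trans[OF norm_sum] sum_mono) auto
      also have "\<dots> \<le> 2 * (N * q_max Q k)"
        using index_set_basics(2)[of k t] card_Diff1_le[of ?A n] N0 q0
        by simp (intro mult_right_mono, auto)
      finally have "cmod (err i j) \<le> 2 * (N * q_max Q k) + D * H"
        unfolding err_def by (intro order_trans[OF norm_triangle_ineq] add_mono H rc D0 rD)
      also have "\<dots> \<le> N * (2 + E * H) * (1 / \<kappa> + q_max Q k)"
      proof -
        have "0 \<le> N * (2 / \<kappa> + E * H * q_max Q k)" using N0 E0 H0 q0 \<kappa> by simp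
        then show ?thesis unfolding D_def by (simp add: algebra_simps)
      qed
      finally show ?thesis .
    qed
    have comp: "(z *s cf n - mean_matrix Q *v cf n) $ i = (\<Sum>j\<in>UNIV. err i j)" for i
    proof -
      have "z * cf n $ i = (\<Sum>j\<in>UNIV. mean_matrix Q $ i $ j * cf n $ j + err i j)"
        using eigenfunction_coeff_eq[OF ef Q, of n i]
        unfolding split by (simp add: z_def cf_def err_def add.assoc)
      then show ?thesis by (simp add: matrix_vector_mult_def sum.distrib)
    qed
    have "norm (mean_matrix Q *v cf n - z *s cf n) \<le> (\<Sum>i\<in>UNIV. cmod (\<Sum>j\<in>UNIV. err i j))"
      unfolding comp[symmetric] norm_minus_commute[of "mean_matrix Q *v cf n"] by (rule norm_vec_le_sum_norms)
    also have "\<dots> \<le> (\<Sum>i\<in>(UNIV :: 'm set). \<Sum>j\<in>(UNIV :: 'm set). N * (2 + E * H) * (1 / \<kappa> + q_max Q k))"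
      by (intro sum_mono order_trans[OF norm_sum] err)
    also have "\<dots> = m * m * (2 + E * H) * (1 / \<kappa> + q_max Q k) * N"
      by (simp add: m_def)
    also have "\<dots> \<le> m * m * (2 + E * H) * (1 / \<kappa> + q_max Q k) * (4 * norm (cf n))"
      using m E0 H0 \<kappa> q0 by (intro mult_left_mono big mult_nonneg_nonneg add_nonneg_nonneg) auto
    also have "\<dots> = C * (1 / \<kappa> + q_max Q k) * norm (cf n)" by (simp add: C_def)
    finally have fin: "norm (mean_matrix Q *v cf n - z *s cf n) \<le> C * (1 / \<kappa> + q_max Q k) * norm (cf n)" .
    have "cf n \<noteq> 0" using big N0 by auto
    with fin n show ?thesis unfolding z_def \<kappa>_def by blast
  qed
  show ?thesis
    by (intro exI[of _ C] exI[of _ K] conjI C1 K0 allI impI main) auto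
qed

section \<open>Localization of the eigenvalues\<close>

theorem theorem3:
  fixes Q :: "real \<Rightarrow> complex^'m^'m" and M c :: real
  assumes "\<And>x. Q (x + pi) = Q x"
    and "\<And>i j. locally_L2 (\<lambda>x. Q x $ i $ j)"
    and "Bloch_bound Q M"
    and "c = M * B_const Q"
  shows "\<exists>c6 > 0. \<forall>k::int. \<bar>k\<bar> > 1 \<and> 4/3 * (2 * real_of_int \<bar>k\<bar> - 1) > 3 * c \<longrightarrow>
    (\<exists>\<epsilon> :: complex \<Rightarrow> real.
       (\<forall>\<mu>\<in>spectrum (to_mat (mean_matrix Q)).
          \<epsilon> \<mu> \<le> c6 * (1 / real_of_int \<bar>k\<bar> + q_max Q k)
                  powr (1 / real (max_Jordan_block (mean_matrix Q) \<mu>))) \<and>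
       (\<forall>t\<in>{-1<..1}.
          L_eigenvalues Q t \<inter> ball (of_real ((2 * of_int k + t)\<^sup>2)) c
          \<subseteq> (\<Union>\<mu>\<in>spectrum (to_mat (mean_matrix Q)).
               \<Union>n\<in>index_set k t. ball (mu_shift n t \<mu>) (\<epsilon> \<mu>))))"
proof -
  have Q: "L2_on {0..pi} (\<lambda>x. Q x $ i $ j)" for i j
    using assms(2) unfolding locally_L2_def by blast
  let ?A = "mean_matrix Q"
  let ?S = "spectrum (to_mat ?A)"
  obtain C K where C1: "C \<ge> 1" and K0: "K \<ge> 0"
    and quasi: "\<And>k t ev. \<bar>k\<bar> > 1 \<Longrightarrow> 4/3 * (2 * real_of_int \<bar>k\<bar> - 1) > 3 * c \<Longrightarrow>
      t \<in> {-1<..1} \<Longrightarrow> ev \<in> L_eigenvalues Q t \<Longrightarrow> cmod (ev - of_real ((2 * of_int k + t)\<^sup>2)) < c \<Longrightarrow>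
      real_of_int \<bar>k\<bar> > K \<Longrightarrow>
      (\<exists>n\<in>index_set k t. \<exists>v. v \<noteq> 0 \<and> norm (?A *v v - (ev - of_real ((2 * of_int n + t)\<^sup>2)) *s v) \<le>
          C * (1 / real_of_int \<bar>k\<bar> + q_max Q k) * norm v)"
    using ex_quasi_eigenvector[OF Q, of c] by blast
  obtain R where R: "\<And>k. q_max Q k \<le> R" using ex_q_max_bound[OF Q] by blast
  obtain C' where C'0: "C' > 0" and near: "\<And>z v \<eta>. v \<noteq> 0 \<Longrightarrow> 0 < \<eta> \<Longrightarrow> \<eta> \<le> C * (1 + R) \<Longrightarrow>
      norm (?A *v v - z *s v) \<le> \<eta> * norm v \<Longrightarrow>
      \<exists>\<mu>\<in>?S. norm (z - \<mu>) < C' * \<eta> powr (1 / real (max_Jordan_block ?A \<mu>))"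
    using quasi_eigenvector_near_spectrum[of "C * (1 + R)" ?A] by blast
  define W where "W = (\<Sum>\<mu>\<in>?S. cmod \<mu>)"
  have W: "cmod \<mu> \<le> W" if "\<mu> \<in> ?S" for \<mu>
    unfolding W_def using that finite_spectrum_to_mat by (intro member_le_sum) auto
  have W0: "W \<ge> 0" unfolding W_def by (simp add: sum_nonneg)
  \<comment> \<open>the first summand serves the large \<open>|k|\<close>, the second makes the disks swallow everything for \<open>|k| \<le> K\<close>\<close>
  define c6 where "c6 = C' * C + (\<bar>c\<bar> + W) * K"
  have c60: "c6 > 0" unfolding c6_def using C1 C'0 W0 K0 by (intro add_pos_nonneg) auto
  show ?thesis
  proof (intro exI[of _ c6] conjI c60 allI impI)
    fix k :: int
    assume k': "\<bar>k\<bar> > 1 \<and> 4/3 * (2 * real_of_int \<bar>k\<bar> - 1) > 3 * c"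
    then have k: "\<bar>k\<bar> > 1" and sep: "4/3 * (2 * real_of_int \<bar>k\<bar> - 1) > 3 * c" by auto
    define \<kappa> where "\<kappa> = real_of_int \<bar>k\<bar>"
    have \<kappa>: "\<kappa> > 1" unfolding \<kappa>_def using k by linarith
    define \<delta> where "\<delta> = 1 / \<kappa> + q_max Q k"
    have q0: "q_max Q k \<ge> 0"
      by (rule q_max_nonneg)
    have \<delta>: "\<delta> > 0" "1 / \<kappa> \<le> \<delta>" "\<delta> \<le> 1 + R"
      unfolding \<delta>_def using \<kappa> q0 R[of k] by (auto intro!: add_pos_nonneg add_mono)
    define \<epsilon> where "\<epsilon> \<mu> = c6 * \<delta> powr (1 / real (max_Jordan_block ?A \<mu>))" for \<mu>
    have incl: "\<exists>\<mu>\<in>?S. \<exists>n\<in>index_set k t. ev \<in> ball (mu_shift n t \<mu>) (\<epsilon> \<mu>)"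
      if t: "t \<in> {-1<..1}" and eig: "ev \<in> L_eigenvalues Q t"
        and ev: "cmod (ev - of_real ((2 * of_int k + t)\<^sup>2)) < c" for t ev
    proof (cases "\<kappa> > K")
      case True
      obtain n v where n: "n \<in> index_set k t" and v: "v \<noteq> 0"
        and res: "norm (?A *v v - (ev - of_real ((2 * of_int n + t)\<^sup>2)) *s v) \<le> C * \<delta> * norm v"
        using quasi[OF k sep t eig ev] True unfolding \<delta>_def \<kappa>_def by blast
      have "0 < C * \<delta>" "C * \<delta> \<le> C * (1 + R)" using C1 \<delta> by auto
      from near[OF v this res] obtain \<mu> where \<mu>: "\<mu> \<in> ?S"
        and lt: "cmod (ev - of_real ((2 * of_int n + t)\<^sup>2) - \<mu>)
          < C' * (C * \<delta>) powr (1 / real (max_Jordan_block ?A \<mu>))" by blast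
      let ?e = "1 / real (max_Jordan_block ?A \<mu>)"
      have e: "0 \<le> ?e" "?e \<le> 1" using max_Jordan_block_pos[OF \<mu>] by auto
      have "C' * (C * \<delta>) powr ?e = C' * (C powr ?e * \<delta> powr ?e)"
        using C1 \<delta> by (simp add: powr_mult)
      also have "\<dots> \<le> C' * (C powr 1 * \<delta> powr ?e)"
        using C1 C'0 e by (intro mult_left_mono mult_right_mono powr_mono) auto
      also have "\<dots> \<le> \<epsilon> \<mu>"
        unfolding \<epsilon>_def c6_def using C1 W0 K0 by (simp add: algebra_simps)
      finally have "cmod (ev - of_real ((2 * of_int n + t)\<^sup>2) - \<mu>) < \<epsilon> \<mu>" using lt by simp
      then have "ev \<in> ball (mu_shift n t \<mu>) (\<epsilon> \<mu>)"
        by (simp add: mu_shift_def dist_norm norm_minus_commute diff_diff_eq)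
      then show ?thesis using \<mu> n by blast
    next
      case False
      obtain \<mu> where \<mu>: "\<mu> \<in> ?S" using spectrum_to_mat_nonempty[of ?A] by blast
      let ?e = "1 / real (max_Jordan_block ?A \<mu>)"
      have e: "0 \<le> ?e" "?e \<le> 1" using max_Jordan_block_pos[OF \<mu>] by auto
      \<comment> \<open>here \<open>1/\<kappa> \<ge> 1/K\<close>, and raising a number below \<open>1\<close> to the power \<open>1/r\<close> only enlarges it\<close>
      have "1 / \<kappa> = (1 / \<kappa>) powr 1" using \<kappa> by simp
      also have "\<dots> \<le> (1 / \<kappa>) powr ?e" using \<kappa> e by (intro powr_mono') auto
      also have "\<dots> \<le> \<delta> powr ?e" using \<delta> e \<kappa> by (intro powr_mono2) auto
      finally have pw: "1 / \<kappa> \<le> \<delta> powr ?e" .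
      have "cmod (ev - of_real ((2 * of_int k + t)\<^sup>2) - \<mu>) \<le>
          cmod (ev - of_real ((2 * of_int k + t)\<^sup>2)) + cmod \<mu>" by (rule norm_triangle_ineq4)
      also have "\<dots> < \<bar>c\<bar> + W" using ev W[OF \<mu>] by linarith
      also have "\<dots> \<le> (\<bar>c\<bar> + W) * K * (1 / \<kappa>)"
      proof -
        have "(\<bar>c\<bar> + W) * \<kappa> \<le> (\<bar>c\<bar> + W) * K" using False W0 by (intro mult_left_mono) auto
        then show ?thesis using \<kappa> by (simp add: field_simps)
      qed
      also have "\<dots> \<le> c6 * \<delta> powr ?e"
        using pw C1 C'0 W0 K0 \<kappa> by (intro mult_mono) (auto simp: c6_def)
      finally have "ev \<in> ball (mu_shift k t \<mu>) (\<epsilon> \<mu>)"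
        by (simp add: \<epsilon>_def mu_shift_def dist_norm norm_minus_commute diff_diff_eq)
      then show ?thesis using \<mu> index_set_basics(3) by blast
    qed
    show "\<exists>\<epsilon> :: complex \<Rightarrow> real.
       (\<forall>\<mu>\<in>?S. \<epsilon> \<mu> \<le> c6 * (1 / real_of_int \<bar>k\<bar> + q_max Q k)
                  powr (1 / real (max_Jordan_block ?A \<mu>))) \<and>
       (\<forall>t\<in>{-1<..1}.
          L_eigenvalues Q t \<inter> ball (of_real ((2 * of_int k + t)\<^sup>2)) c
          \<subseteq> (\<Union>\<mu>\<in>?S. \<Union>n\<in>index_set k t. ball (mu_shift n t \<mu>) (\<epsilon> \<mu>)))"
    proof (intro exI[of _ \<epsilon>] conjI ballI subsetI)
      show "\<epsilon> \<mu> \<le> c6 * (1 / real_of_int \<bar>k\<bar> + q_max Q k)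
                  powr (1 / real (max_Jordan_block ?A \<mu>))" for \<mu>
        by (simp add: \<epsilon>_def \<delta>_def \<kappa>_def)
      fix t ev assume "t \<in> {-1<..1}" "ev \<in> L_eigenvalues Q t \<inter> ball (of_real ((2 * of_int k + t)\<^sup>2)) c"
      then show "ev \<in> (\<Union>\<mu>\<in>?S. \<Union>n\<in>index_set k t. ball (mu_shift n t \<mu>) (\<epsilon> \<mu>))"
        using incl[of t ev] by (auto simp: dist_norm norm_minus_commute)
    qed
  qed
qed

end
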